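(* Let $(X,\sigma)$ be a classical symbolic system (a two-sided subshift $X\subset\Lambda^{\mathbb Z}$ or a one-sided subshift $X\subset\Lambda^{\mathbb N_0}$ over a finite alphabet $\Lambda$) such that $\mathcal M_\sigma(X)$ is a Bauer simplex, that is, the set $\mathcal M^{\mathsf{erg}}_\sigma(X)$ is closed in $\mathcal M(X)$. Let $\mathcal U\supset\mathcal M^{\mathsf{erg}}_\sigma(X)$ be an open set in $\mathcal B^*(X)\cup\mathcal M(X)$ (with the metric $d^*$). Then for every $\varepsilon>0$ there exists $k_0\in\mathbb N$ such that for every $x\in X$ and any decomposition $x=\dots C_{-2}C_{-1}C_1C_2\dots$ (respectively $x=C_1C_2\dots$ in the case of a one-sided subshift) into blocks $C_j$ whose lengths are larger than or equal to $k_0$ and bounded from above, the set of coordinates pertaining to the nonergodic blocks $C_j$ (i.e. those with $C_j\notin\mathcal U$) in this concatenation has upper Banach density smaller than $\varepsilon$.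
   Context: $\Lambda$ is a finite discrete set. The shift is $(\sigma(x))(i)=x(i+1)$. A two-sided (one-sided) subshift is a closed subset $X$ of $\Lambda^{\mathbb Z}$ (resp. $\Lambda^{\mathbb N_0}$) invariant under $\sigma$ (i.e. $\sigma(X)=X$ in the two-sided case, $\sigma(X)\subset X$ in the one-sided case). Coordinates $i$ range over $\mathbb Z$ (resp. $\mathbb N_0$). A block of length $k$ is an element $B\in\Lambda^k$, $|B|=k$. $\mathcal B^*(X)$ is the set of all blocks occurring in elements of $X$, i.e. blocks of the form $x|_{[i,i+k)}$ with $x\in X$ (regarded as elements of $\Lambda^k$). A decomposition of $x$ into blocks means that the set of all coordinates is partitioned into consecutive finite intervals and the blocks are the restrictions of $x$ to these intervals. For $B\in\Lambda^k$, $C\in\Lambda^l$ with $l\le k$, $\mathrm{Fr}_B(C)=\frac1k|\{i\in[0,k-l]: B|_{[i,i+l)}=C\}|$; if $l>k$, $\mathrm{Fr}_B(C)=0$. $\mathcal M(X)$ is the set of Borel probability measures on $X$ (with the weak-$\star$ topology), $\mathcal M_\sigma(X)$ the shift-invariant ones, $\mathcal M^{\mathsf{erg}}_\sigma(X)$ the ergodic ones. $[C]=\{x\in X: x|_{[0,l)}=C\}$ for $C\in\Lambda^l$. For $p\in\mathcal B^*(X)\cup\mathcal M(X)$ put $p(C)=\mathrm{Fr}_p(C)$ if $p$ is a block and $p(C)=p([C])$ if $p$ is a measure. The metric on $\mathcal B^*(X)\cup\mathcal M(X)$ is $d^*(p,q)=\sum_{l=1}^{\infty}2^{-l}\sum_{C\in\Lambda^l}|p(C)-q(C)|$;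 on $\mathcal M(X)$ it is compatible with the weak-$\star$ topology. Upper Banach density of a set $A$ of coordinates: $\overline d_{\mathsf{Ban}}(A)=\inf_{N\in\mathbb N}\sup_i\frac{|A\cap[i,i+N)|}{N}$. *)

theory Defs
  imports "HOL-Probability.Probability" "HOL-Library.Disjoint_Sets"
begin

text \<open>
  Coordinates form a type \<open>'i\<close>, used only with \<open>'i = int\<close> (two-sided) and \<open>'i = nat\<close> (one-sided).
  The alphabet is a finite type with the discrete topology, so that the library topology on
  \<open>'i \<Rightarrow> 'a\<close> is the product topology.
\<close>

definition shift :: "('i::linordered_semidom \<Rightarrow> 'a) \<Rightarrow> ('i \<Rightarrow> 'a)" where
  "shift x = (\<lambda>i. x (i + 1))"

definition two_sided_subshift :: "(int \<Rightarrow> 'a::{finite,discrete_topology}) set \<Rightarrow> bool" where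
  "two_sided_subshift X \<longleftrightarrow> closed X \<and> shift ` X = X"

definition one_sided_subshift :: "(nat \<Rightarrow> 'a::{finite,discrete_topology}) set \<Rightarrow> bool" where
  "one_sided_subshift X \<longleftrightarrow> closed X \<and> shift ` X \<subseteq> X"

subsection \<open>Blocks\<close>

text \<open>\<open>subblock x i k\<close> is the restriction of \<open>x\<close> to \<open>[i, i + k)\<close>, read as a word of length \<open>k\<close>.\<close>

definition subblock :: "('i::linordered_semidom \<Rightarrow> 'a) \<Rightarrow> 'i \<Rightarrow> nat \<Rightarrow> 'a list" where
  "subblock x i k = map (\<lambda>j. x (i + of_nat j)) [0..<k]"

definition blocks :: "('i::linordered_semidom \<Rightarrow> 'a) set \<Rightarrow> 'a list set" where
  "blocks X = {subblock x i k | x i k. x \<in> X \<and> k \<ge> 1}"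

definition Fr :: "'a list \<Rightarrow> 'a list \<Rightarrow> real" where
  "Fr B C =
    (if length C \<le> length B
     then real (card {i. i \<le> length B - length C \<and> take (length C) (drop i B) = C})
            / real (length B)
     else 0)"

subsection \<open>Measures\<close>

definition prob_measures ::
  "('i::linordered_semidom \<Rightarrow> 'a::{finite,discrete_topology}) set \<Rightarrow> ('i \<Rightarrow> 'a) measure set" where
  "prob_measures X = {\<mu>. prob_space \<mu> \<and> space \<mu> = X \<and> sets \<mu> = sets (restrict_space borel X)}"

definition invariant_measures ::
  "('i::linordered_semidom \<Rightarrow> 'a::{finite,discrete_topology}) set \<Rightarrow> ('i \<Rightarrow> 'a) measure set" where
  "invariant_measures X =
    {\<mu> \<in> prob_measures X. \<forall>A\<in>sets \<mu>. measure \<mu> (shift -` A \<inter> X) = measure \<mu> A}"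

definition ergodic_measures ::
  "('i::linordered_semidom \<Rightarrow> 'a::{finite,discrete_topology}) set \<Rightarrow> ('i \<Rightarrow> 'a) measure set" where
  "ergodic_measures X =
    {\<mu> \<in> invariant_measures X.
       \<forall>A\<in>sets \<mu>. shift -` A \<inter> X = A \<longrightarrow> measure \<mu> A = 0 \<or> measure \<mu> A = 1}"

text \<open>
  The coarsest topology on \<open>prob_measures X\<close> making \<open>\<mu> \<mapsto> \<integral> f d\<mu>\<close> continuous for every
  continuous real function \<open>f\<close> on \<open>X\<close>.
\<close>

definition weak_star ::
  "('i::linordered_semidom \<Rightarrow> 'a::{finite,discrete_topology}) set \<Rightarrow> ('i \<Rightarrow> 'a) measure topology" where
  "weak_star X = topology_generated_by
    {{\<mu> \<in> prob_measures X. integral\<^sup>L \<mu> f \<in> V} | (f :: ('i \<Rightarrow> 'a) \<Rightarrow> real) V.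
       continuous_on X f \<and> open V}"

subsection \<open>The space of blocks and measures\<close>

definition blocks_measures ::
  "('i::linordered_semidom \<Rightarrow> 'a::{finite,discrete_topology}) set
    \<Rightarrow> ('a list + ('i \<Rightarrow> 'a) measure) set" where
  "blocks_measures X = Inl ` blocks X \<union> Inr ` prob_measures X"

fun val :: "'a list + ('i::linordered_semidom \<Rightarrow> 'a) measure \<Rightarrow> 'a list \<Rightarrow> real" where
  "val (Inl B) C = Fr B C"
| "val (Inr \<mu>) C = measure \<mu> {x \<in> space \<mu>. subblock x 0 (length C) = C}"

text \<open>The summation index is shifted by one: the summand \<open>l\<close> treats words of length \<open>l + 1\<close>.\<close>

definition dstar ::
  "'a::finite list + ('i::linordered_semidom \<Rightarrow> 'a) measure \<Rightarrow> 'a list + ('i \<Rightarrow> 'a) measure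
    \<Rightarrow> real" where
  "dstar p q = (\<Sum>l. (1 / 2) ^ Suc l * (\<Sum>C\<in>{C. length C = Suc l}. \<bar>val p C - val q C\<bar>))"

text \<open>
  Openness is spelled out with balls rather than taken from the locale \<open>Metric_space\<close>: over
  \<open>int\<close>, the cylinders at coordinates \<open>\<ge> 0\<close> do not separate measures that are not
  shift-invariant, so there \<open>dstar\<close> is only a pseudometric.  It does separate invariant measures.
\<close>

definition dstar_open ::
  "('i::linordered_semidom \<Rightarrow> 'a::{finite,discrete_topology}) set
    \<Rightarrow> ('a list + ('i \<Rightarrow> 'a) measure) set \<Rightarrow> bool" where
  "dstar_open X U \<longleftrightarrow> U \<subseteq> blocks_measures X \<and>
    (\<forall>p\<in>U. \<exists>r>0. \<forall>q\<in>blocks_measures X. dstar p q < r \<longrightarrow> q \<in> U)"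

subsection \<open>Decompositions and density\<close>

text \<open>
  A decomposition is given by the set of pairs (starting coordinate, length) of its intervals.
  A partition of all coordinates into nonempty finite intervals is automatically ordered like
  \<open>int\<close> (respectively \<open>nat\<close>), so no enumeration of the intervals is needed.
\<close>

definition decomposition :: "('i::linordered_semidom \<times> nat) set \<Rightarrow> bool" where
  "decomposition D \<longleftrightarrow> partition_on UNIV ((\<lambda>(i, n). {i..<i + of_nat n}) ` D)"

definition nonergodic_coords ::
  "('a list + ('i::linordered_semidom \<Rightarrow> 'a) measure) set \<Rightarrow> ('i \<Rightarrow> 'a) \<Rightarrow> ('i \<times> nat) set
    \<Rightarrow> 'i set" where
  "nonergodic_coords U x D =
    (\<Union>(i, n)\<in>{(i, n) \<in> D. Inl (subblock x i n) \<notin> U}. {i..<i + of_nat n})"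

definition upper_banach_density :: "'i::linordered_semidom set \<Rightarrow> real" where
  "upper_banach_density A =
    (INF N\<in>{1..}. SUP i. real (card (A \<inter> {i..<i + of_nat N})) / real N)"

end

theory Submission
  imports Defs
begin

text \<open>
  By von Neumann's theorem the averages of a cylinder over \<open>n\<close> shifts have variance tending to
  \<open>0\<close> under each ergodic measure; since the ergodic measures form a compact set and the
  variances almost decrease in \<open>n\<close>, this is uniform.  By Markov's inequality the set of points
  whose orbit segment of length \<open>M\<close> deviates from every ergodic measure (in the mean square of
  these \<open>n\<close>-averages) then has small ergodic measure, whatever \<open>M\<close> is.  It is clopen, and the
  maximum of an invariant measure of a clopen set is attained at an ergodic measure, so orbits visit
  this set with small frequency, uniformly in \<open>X\<close>.  If \<open>M\<close> is much larger than the blocks,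
  an orbit segment close to an ergodic measure \<open>\<nu>\<close> in this sense contains few coordinates of
  blocks outside \<open>U\<close>, because every long such block is far from \<open>\<nu>\<close> and makes a definite
  contribution to the mean square deviation.
\<close>

subsection \<open>Cylinder sets\<close>

text \<open>The obstacle is the order of the choices. \<open>k0\<close> may depend on
  \<open>U\<close> and \<open>\<epsilon>\<close> only, while the upper bound \<open>K\<close> on the
  block lengths comes later with the decomposition, and nothing relates it to \<open>k0\<close>. So
  the averaging length \<open>n\<close> is fixed before \<open>k0\<close>, but the window length
  \<open>M\<close> only after \<open>K\<close>, because the blocks cut by the ends of a window can
  cost 2 K of its M coordinates. This is why deviations are measured by summing squared errors of
  \<open>n\<close>-averages along the window: by invariance the integral of that sum is M times the
  integral of one term, so Markov's bound is the same for every \<open>M\<close>. Squares are also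
  what sees single blocks: deviations of opposite sign in different blocks could cancel in the word
  frequencies of the whole window, but not in a sum of squares. Quantifying over all ergodic
  measures in \<open>erratic\<close> works in both directions: under an ergodic \<nu> an erratic
  point deviates from \<nu> itself, and a window that is not erratic has one \<nu> that serves for
  all of its blocks.\<close>

definition cylinder :: "('i \<Rightarrow> 'a) set \<Rightarrow> bool" where
  "cylinder B \<longleftrightarrow>
    (\<exists>F. finite F \<and> (\<forall>x y. (\<forall>i\<in>F. x i = y i) \<longrightarrow> (x \<in> B \<longleftrightarrow> y \<in> B)))"

lemma cylinderI:
  assumes "finite F" "\<And>x y. (\<And>i. i \<in> F \<Longrightarrow> x i = y i) \<Longrightarrow> x \<in> B \<Longrightarrow> y \<in> B"
  shows "cylinder B"
  unfolding cylinder_def using assms by (intro exI[of _ F]) (metis (full_types))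

lemma cylinder_empty [simp]: "cylinder {}" and cylinder_UNIV [simp]: "cylinder UNIV"
  by (auto simp: cylinder_def)

lemma cylinder_Compl: "cylinder B \<Longrightarrow> cylinder (- B)"
  unfolding cylinder_def by auto

lemma cylinder_Int:
  assumes "cylinder A" "cylinder B"
  shows "cylinder (A \<inter> B)"
proof -
  obtain F where F: "finite F" "\<forall>x y. (\<forall>i\<in>F. x i = y i) \<longrightarrow> (x \<in> A \<longleftrightarrow> y \<in> A)"
    using assms(1) unfolding cylinder_def by auto
  obtain G where G: "finite G" "\<forall>x y. (\<forall>i\<in>G. x i = y i) \<longrightarrow> (x \<in> B \<longleftrightarrow> y \<in> B)"
    using assms(2) unfolding cylinder_def by auto
  show ?thesis
  proof (rule cylinderI[of "F \<union> G"])
    show "y \<in> A \<inter> B" if "\<And>i. i \<in> F \<union> G \<Longrightarrow> x i = y i" "x \<in> A \<inter> B" for x y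
      using F(2)[rule_format, of x y] G(2)[rule_format, of x y] that by simp
  qed (use F G in simp)
qed

lemma cylinder_Un: "cylinder A \<Longrightarrow> cylinder B \<Longrightarrow> cylinder (A \<union> B)"
  using cylinder_Compl[of "- A \<inter> - B"] by (simp add: cylinder_Int cylinder_Compl)

text \<open>A cylinder is determined by a finite coordinate set and a set of patterns on it.
  Countability turns unions of cylinders into countable ones and lets sequences of numbers encode
  measures.\<close>

lemma countable_cylinders: "countable {B :: ('i::countable \<Rightarrow> 'a::finite) set. cylinder B}"
proof -
  have "{B :: ('i \<Rightarrow> 'a) set. cylinder B} \<subseteq>
      (\<Union>F\<in>Collect finite. (\<lambda>S. {x. restrict x F \<in> S}) ` Pow (F \<rightarrow>\<^sub>E UNIV))"
  proof (intro subsetI, simp only: mem_Collect_eq)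
    fix B :: "('i \<Rightarrow> 'a) set" assume "cylinder B"
    then obtain F where F: "finite F" "\<forall>x y. (\<forall>i\<in>F. x i = y i) \<longrightarrow> (x \<in> B \<longleftrightarrow> y \<in> B)"
      unfolding cylinder_def by auto
    let ?S = "(\<lambda>x. restrict x F) ` B"
    have "x \<in> B" if "restrict x F = restrict y F" "y \<in> B" for x y
      using F(2)[rule_format, of x y] fun_cong[OF that(1)] that(2) by (simp add: restrict_def split: if_splits) metis
    then have "B = {x. restrict x F \<in> ?S}" by auto
    moreover have "?S \<subseteq> F \<rightarrow>\<^sub>E UNIV" by auto
    ultimately show "B \<in> (\<Union>F\<in>Collect finite. (\<lambda>S. {x. restrict x F \<in> S}) ` Pow (F \<rightarrow>\<^sub>E UNIV))"
      using F(1) by blast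
  qed
  moreover have "countable
      (\<Union>F\<in>Collect finite. (\<lambda>S. {x :: 'i \<Rightarrow> 'a. restrict x F \<in> S}) ` Pow (F \<rightarrow>\<^sub>E UNIV))"
    by (intro countable_UN countable_Collect_finite countable_image countable_finite)
       (auto intro!: finite_PiE)
  ultimately show ?thesis by (rule countable_subset)
qed

lemma open_cylinder:
  fixes B :: "('i \<Rightarrow> 'a::discrete_topology) set"
  assumes "cylinder B"
  shows "open B"
proof -
  obtain F where F: "finite F" "\<forall>x y. (\<forall>i\<in>F. x i = y i) \<longrightarrow> (x \<in> B \<longleftrightarrow> y \<in> B)"
    using assms unfolding cylinder_def by auto
  have "\<exists>T. open T \<and> x \<in> T \<and> T \<subseteq> B" if "x \<in> B" for x
  proof (intro exI conjI)
    let ?T = "PiE UNIV (\<lambda>i. if i \<in> F then {x i} else UNIV)"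
    show "open ?T"
      by (rule open_PiE) (use F(1) in \<open>auto intro: discrete_topology_class.open_discrete finite_subset\<close>)
    show "x \<in> ?T" by auto
    show "?T \<subseteq> B"
    proof
      fix y assume "y \<in> ?T"
      then have "y i = x i" if "i \<in> F" for i
        using that by (auto simp: PiE_iff split: if_splits dest: spec[of _ i])
      then show "y \<in> B" using F(2)[rule_format, of x y] that by auto
    qed
  qed
  then show ?thesis by (subst open_subopen) auto
qed

lemma closed_cylinder:
  fixes B :: "('i \<Rightarrow> 'a::discrete_topology) set"
  shows "cylinder B \<Longrightarrow> closed B"
  using open_cylinder[OF cylinder_Compl] by (auto simp: closed_def)

lemma open_contains_cylinder:
  fixes S :: "('i \<Rightarrow> 'a::discrete_topology) set"
  assumes "open S" "x \<in> S"
  obtains B where "cylinder B" "x \<in> B" "B \<subseteq> S"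
proof -
  have "openin (product_topology (\<lambda>i. euclidean) UNIV) S"
    using assms(1) by (simp add: euclidean_product_topology)
  from product_topology_open_contains_basis[OF this assms(2)] obtain X
    where X: "x \<in> PiE UNIV X" "finite {i. X i \<noteq> UNIV}" "PiE UNIV X \<subseteq> S"
    by auto
  let ?F = "{i. X i \<noteq> UNIV}"
  show ?thesis
  proof (rule that)
    show "cylinder {y. \<forall>i\<in>?F. y i = x i}"
      by (rule cylinderI[OF X(2)]) auto
    show "{y. \<forall>i\<in>?F. y i = x i} \<subseteq> S"
    proof
      fix y assume "y \<in> {y. \<forall>i\<in>?F. y i = x i}"
      then have "y i \<in> X i" for i
        using X(1) by (cases "X i = UNIV") (auto simp: PiE_iff)
      then show "y \<in> S" using X(3) by auto
    qed
  qed simp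
qed

text \<open>An open set is the union of all cylinders inside it, and there are only countably many
  of them.\<close>

lemma borel_eq_sigma_cylinders:
  "sets (borel :: ('i::countable \<Rightarrow> 'a::{finite,discrete_topology}) measure) =
     sigma_sets UNIV {B. cylinder B}"
proof
  have "S \<in> sigma_sets UNIV {B. cylinder B}" if "open S" for S :: "('i \<Rightarrow> 'a) set"
  proof -
    let ?C = "{B. cylinder B \<and> B \<subseteq> S}"
    have "S = \<Union>?C"
      by (auto elim!: open_contains_cylinder[OF that])
    moreover have "countable ?C"
      by (rule countable_subset[OF _ countable_cylinders]) auto
    moreover have "\<Union>?C \<in> sigma_sets UNIV {B. cylinder B}"
      using \<open>countable ?C\<close> by (rule sigma_sets_UNION) auto
    ultimately show ?thesis by simp
  qed
  then show "sets (borel :: ('i \<Rightarrow> 'a) measure) \<subseteq> sigma_sets UNIV {B. cylinder B}"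
    unfolding borel_def by (auto intro!: sigma_sets_mono)
  have "cylinder B \<Longrightarrow> B \<in> sets borel" for B :: "('i \<Rightarrow> 'a) set"
    by (simp add: open_cylinder)
  then have "{B. cylinder B} \<subseteq> sets (borel :: ('i \<Rightarrow> 'a) measure)" by auto
  then show "sigma_sets UNIV {B. cylinder B} \<subseteq> sets (borel :: ('i \<Rightarrow> 'a) measure)"
    by (metis sets.sigma_sets_subset space_borel)
qed

lemma compact_function_space: "compact (UNIV :: ('i \<Rightarrow> 'a::{finite,topological_space}) set)"
proof -
  have "compact_space (product_topology (\<lambda>i::'i. euclidean :: 'a topology) UNIV)"
    unfolding compact_space_product_topology
    by (auto simp: compact_space_def finite_imp_compact)
  then show ?thesis
    by (simp add: euclidean_product_topology compact_space_def)
qed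

subsection \<open>Compactness of the space of measures\<close>

locale shift_space =
  fixes X :: "('i::{linordered_semidom,countable} \<Rightarrow> 'a::{finite,discrete_topology}) set"
  assumes closed: "closed X"
    and shift_subset: "shift ` X \<subseteq> X"
begin

text \<open>A sequential substitute for weak-star convergence that avoids metrizing the topology.
  Indicators of cylinders are continuous, and their linear combinations approximate every continuous
  function uniformly on \<open>X\<close>, so integrals of continuous functions converge as
  well.\<close>

definition tends_to ::
  "(nat \<Rightarrow> ('i \<Rightarrow> 'a) measure) \<Rightarrow> ('i \<Rightarrow> 'a) measure \<Rightarrow> bool" where
  "tends_to ms m \<longleftrightarrow>
    (\<forall>B. cylinder B \<longrightarrow> (\<lambda>k. measure (ms k) (B \<inter> X)) \<longlonglongrightarrow> measure m (B \<inter> X))"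

lemma tends_toD:
  "tends_to ms m \<Longrightarrow> cylinder B \<Longrightarrow> (\<lambda>k. measure (ms k) (B \<inter> X)) \<longlonglongrightarrow> measure m (B \<inter> X)"
  by (simp add: tends_to_def)

lemma compact_X: "compact X"
  using compact_Int_closed[OF compact_function_space closed] by simp

lemma sets_X_eq: "sets (restrict_space borel X) = sigma_sets X ((\<lambda>B. B \<inter> X) ` {B. cylinder B})"
proof -
  have "X \<in> sigma_sets UNIV {B. cylinder B}"
    using closed unfolding borel_eq_sigma_cylinders[symmetric] by simp
  then have "sets (restrict_space borel X) = sigma_sets X ((\<inter>) X ` {B. cylinder B})"
    unfolding sets_restrict_space borel_eq_sigma_cylinders by (rule sigma_sets_Int) simp
  also have "(\<inter>) X = (\<lambda>B. B \<inter> X)" by auto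
  finally show ?thesis .
qed

lemma prob_measuresD:
  assumes "\<mu> \<in> prob_measures X"
  shows "prob_space \<mu>" "space \<mu> = X" "sets \<mu> = sets (restrict_space borel X)"
  using assms by (auto simp: prob_measures_def)

lemma cylinder_in_sets:
  assumes "\<mu> \<in> prob_measures X" "cylinder B"
  shows "B \<inter> X \<in> sets \<mu>"
  using assms by (auto simp: prob_measuresD(3) sets_X_eq)

lemma prob_measures_eqI:
  assumes \<mu>: "\<mu> \<in> prob_measures X" and \<nu>: "\<nu> \<in> prob_measures X"
    and eq: "\<And>B. cylinder B \<Longrightarrow> measure \<mu> (B \<inter> X) = measure \<nu> (B \<inter> X)"
  shows "\<mu> = \<nu>"
proof -
  interpret \<mu>: prob_space \<mu> using \<mu> by (rule prob_measuresD)
  interpret \<nu>: prob_space \<nu> using \<nu> by (rule prob_measuresD)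
  let ?E = "(\<lambda>B. B \<inter> X) ` {B. cylinder B}"
  show ?thesis
  proof (rule measure_eqI_generator_eq[where E = ?E and \<Omega> = X and A = "\<lambda>_. X"])
    show "Int_stable ?E"
    proof (rule Int_stableI, elim imageE CollectE)
      fix A B C D :: "('i \<Rightarrow> 'a) set"
      assume "A = C \<inter> X" "cylinder C" "B = D \<inter> X" "cylinder D"
      then show "A \<inter> B \<in> ?E"
        by (intro image_eqI[of _ _ "C \<inter> D"]) (auto simp: cylinder_Int)
    qed
    show "emeasure \<mu> A = emeasure \<nu> A" if "A \<in> ?E" for A
      using that eq by (auto simp: \<mu>.emeasure_eq_measure \<nu>.emeasure_eq_measure)
    show "sets \<mu> = sigma_sets X ?E" "sets \<nu> = sigma_sets X ?E"
      using \<mu> \<nu> by (simp_all add: prob_measuresD sets_X_eq)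
    show "range (\<lambda>_::nat. X) \<subseteq> ?E"
      by (auto intro!: image_eqI[of _ _ UNIV])
  qed auto
qed

text \<open>The values of a measure on all cylinders form a point of a countable power of [0,1],
  which is sequentially compact. A limit of such points is still additive on the algebra of
  cylinders, and Caratheodory's theorem extends it to a measure.\<close>

lemma prob_measures_compact:
  assumes ms: "\<And>k::nat. ms k \<in> prob_measures X"
  obtains r m where "strict_mono r" "m \<in> prob_measures X" "tends_to (ms \<circ> r) m"
proof -
  interpret ms: prob_space "ms k" for k :: nat using ms by (rule prob_measuresD)
  let ?C = "{B :: ('i \<Rightarrow> 'a) set. cylinder B}"
  define c where "c = from_nat_into ?C"
  define v where "v k = (\<lambda>n. measure (ms k) (c n \<inter> X))" for k :: nat
  have "compact (PiE UNIV (\<lambda>_::nat. {0..1::real}))"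
    using compactin_PiE[of "\<lambda>_::nat. euclidean :: real topology" UNIV "\<lambda>_. {0..1}"]
    by (simp add: euclidean_product_topology)
  then have "seq_compact (PiE UNIV (\<lambda>_::nat. {0..1::real}))"
    by (rule compact_imp_seq_compact)
  moreover have "\<forall>k. v k \<in> PiE UNIV (\<lambda>_::nat. {0..1::real})"
    by (auto simp: v_def)
  ultimately obtain l r where r: "strict_mono r" "(v \<circ> r) \<longlonglongrightarrow> l"
    by (auto elim!: seq_compactE[where f = v])
  have conv: "\<exists>l\<ge>0. (\<lambda>k. measure (ms (r k)) (B \<inter> X)) \<longlonglongrightarrow> l" if B: "cylinder B" for B
  proof -
    obtain n where n: "c n = B"
      using from_nat_into_surj[OF countable_cylinders, of B] B unfolding c_def by auto
    have "isCont (\<lambda>f::nat \<Rightarrow> real. f n) l"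
      using continuous_on_product_coordinates by (rule continuous_on_interior) simp
    then have "(\<lambda>k. (v \<circ> r) k n) \<longlonglongrightarrow> l n"
      using r(2) by (rule isCont_tendsto_compose)
    then have "(\<lambda>k. measure (ms (r k)) (B \<inter> X)) \<longlonglongrightarrow> l n"
      by (simp add: v_def o_def n)
    then show ?thesis
      by (intro exI[of _ "l n"]) (auto intro: LIMSEQ_le_const)
  qed
  define f where "f A = lim (\<lambda>k. measure (ms (r k)) A)" for A
  let ?M = "(\<lambda>B. B \<inter> X) ` ?C"
  have lim: "(\<lambda>k. measure (ms (r k)) A) \<longlonglongrightarrow> f A" and f0: "f A \<ge> 0" if "A \<in> ?M" for A
  proof -
    from that obtain B where B: "A = B \<inter> X" "cylinder B" by auto
    with conv obtain l where l: "l \<ge> 0" "(\<lambda>k. measure (ms (r k)) A) \<longlonglongrightarrow> l" by blast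
    moreover from l(2) have "f A = l" unfolding f_def by (rule limI)
    ultimately show "(\<lambda>k. measure (ms (r k)) A) \<longlonglongrightarrow> f A" "f A \<ge> 0" by auto
  qed
  have in_sets: "A \<in> sets (ms k)" if A: "A \<in> ?M" for A k
  proof -
    from A obtain B where "A = B \<inter> X" "cylinder B" by auto
    then show ?thesis by (simp add: cylinder_in_sets[OF ms])
  qed
  have "algebra X ?M"
  proof (subst algebra_iff_Un, intro conjI ballI)
    show "?M \<subseteq> Pow X" "{} \<in> ?M" by (auto intro!: image_eqI[of _ _ "{}"])
    show "X - A \<in> ?M" if "A \<in> ?M" for A
    proof -
      from that obtain B where "A = B \<inter> X" "cylinder B" by auto
      then show ?thesis by (intro image_eqI[of _ _ "- B"]) (auto simp: cylinder_Compl)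
    qed
    show "A \<union> B \<in> ?M" if "A \<in> ?M" "B \<in> ?M" for A B
    proof -
      from that obtain C D where "A = C \<inter> X" "cylinder C" "B = D \<inter> X" "cylinder D" by auto
      then show ?thesis by (intro image_eqI[of _ _ "C \<union> D"]) (auto simp: cylinder_Un)
    qed
  qed
  then have ring: "ring_of_sets X ?M" by (rule algebra.axioms)
  have f_empty: "f {} = 0" by (simp add: f_def)
  have mono: "f A \<le> f B" if "A \<in> ?M" "B \<in> ?M" "A \<subseteq> B" for A B
  proof (rule LIMSEQ_le[OF lim[OF that(1)] lim[OF that(2)]])
    have "measure (ms (r k)) A \<le> measure (ms (r k)) B" for k
      by (rule ms.finite_measure_mono[OF that(3) in_sets[OF that(2)]])
    then show "\<exists>N. \<forall>k\<ge>N. measure (ms (r k)) A \<le> measure (ms (r k)) B" by blast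
  qed
  have add: "f (A \<union> B) = f A + f B" if "A \<in> ?M" "B \<in> ?M" "A \<inter> B = {}" for A B
  proof -
    have "measure (ms (r k)) (A \<union> B) = measure (ms (r k)) A + measure (ms (r k)) B" for k
      by (rule ms.finite_measure_Union[OF in_sets[OF that(1)] in_sets[OF that(2)] that(3)])
    then have "(\<lambda>k. measure (ms (r k)) (A \<union> B)) \<longlonglongrightarrow> f A + f B"
      using tendsto_add[OF lim[OF that(1)] lim[OF that(2)]] by simp
    then show ?thesis unfolding f_def by (rule limI)
  qed
  have "\<exists>\<mu> :: ('i \<Rightarrow> 'a) set \<Rightarrow> ennreal.
      (\<forall>A\<in>?M. \<mu> A = ennreal (f A)) \<and> measure_space X (sigma_sets X ?M) \<mu>"
  proof (rule ring_of_sets.caratheodory_empty_continuous[OF ring])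
    show "positive ?M (\<lambda>A. ennreal (f A))"
      by (simp add: positive_def f_empty)
    show "additive ?M (\<lambda>A. ennreal (f A))"
      unfolding additive_def
    proof (intro ballI impI)
      fix A B assume AB: "A \<in> ?M" "B \<in> ?M" "A \<inter> B = {}"
      show "ennreal (f (A \<union> B)) = ennreal (f A) + ennreal (f B)"
        unfolding add[OF AB] by (rule ennreal_plus[OF f0[OF AB(1)] f0[OF AB(2)]])
    qed
    fix A :: "nat \<Rightarrow> ('i \<Rightarrow> 'a) set"
    assume A: "range A \<subseteq> ?M" "decseq A" "(\<Inter>i. A i) = {}"
    \<comment> \<open>Cylinders are compact, so countable additivity on them is automatic.\<close>
    have "\<exists>n. A n = {}"
    proof (rule ccontr)
      assume ne: "\<nexists>n. A n = {}"
      have "X \<inter> (\<Inter>n\<in>UNIV. A n) \<noteq> {}"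
      proof (rule compact_imp_fip_image[OF compact_X])
        show "closed (A n)" for n
        proof -
          have "A n \<in> ?M" using A(1) by (rule range_subsetD)
          then obtain B where "A n = B \<inter> X" "cylinder B" by (elim imageE CollectE)
          then show ?thesis using closed_Int[OF closed_cylinder closed] by metis
        qed
        show "X \<inter> (\<Inter>i\<in>I. A i) \<noteq> {}" if "finite I" "I \<subseteq> UNIV" for I
        proof -
          obtain N where N: "\<forall>i\<in>I. i \<le> N" using finite_nat_set_iff_bounded_le[of I] \<open>finite I\<close> by blast
          have "A N \<subseteq> X \<inter> (\<Inter>i\<in>I. A i)"
          proof
            fix x assume x: "x \<in> A N"
            have "A N \<subseteq> X" using range_subsetD[OF A(1), of N] by auto
            moreover have "A N \<subseteq> A i" if "i \<in> I" for i
              using A(2) N that by (auto simp: decseq_def)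
            ultimately show "x \<in> X \<inter> (\<Inter>i\<in>I. A i)" using x by blast
          qed
          with ne show ?thesis by (metis subset_empty)
        qed
      qed
      then show False using A(3) by auto
    qed
    then obtain n where n: "A n = {}" ..
    \<comment> \<open>Continuity at the empty set is trivial here: a decreasing sequence of
      cylinders with empty intersection is empty from some index on.\<close>
    have "\<forall>\<^sub>F k in sequentially. ennreal (f (A k)) = 0"
      using eventually_ge_at_top[of n]
    proof eventually_elim
      case (elim k)
      then have "A k = {}" using n A(2) by (auto simp: decseq_def)
      then show ?case by (simp add: f_empty)
    qed
    then show "(\<lambda>k. ennreal (f (A k))) \<longlonglongrightarrow> 0" by (rule tendsto_eventually)
  qed simp
  then obtain \<mu> where \<mu>: "\<And>A. A \<in> ?M \<Longrightarrow> \<mu> A = ennreal (f A)"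
    "measure_space X (sigma_sets X ?M) \<mu>" by auto
  define m where "m = measure_of X (sigma_sets X ?M) \<mu>"
  have sa: "sigma_algebra X (sigma_sets X ?M)" "positive (sigma_sets X ?M) \<mu>"
    "countably_additive (sigma_sets X ?M) \<mu>"
    using \<mu>(2) by (auto simp: measure_space_def)
  have space: "space m = X"
    unfolding m_def by (rule sigma_algebra.space_measure_of_eq[OF sa(1)])
  have sets: "sets m = sigma_sets X ?M"
    unfolding m_def by (rule sigma_algebra.sets_measure_of_eq[OF sa(1)])
  have em: "emeasure m A = ennreal (f A)" if "A \<in> ?M" for A
    unfolding m_def using emeasure_measure_of_sigma[OF sa, of A] \<mu>(1)[OF that] that by auto
  have XM: "X \<in> ?M" by (auto intro!: image_eqI[of _ _ UNIV])
  have "f X = 1"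
  proof -
    have "measure (ms (r k)) X = 1" for k
      using ms.prob_space[of "r k"] ms by (simp add: prob_measuresD)
    then show ?thesis by (simp add: f_def)
  qed
  then have "prob_space m"
    by (intro prob_spaceI) (use em[OF XM] space in simp)
  then have m: "m \<in> prob_measures X"
    by (simp add: prob_measures_def space sets sets_X_eq)
  moreover have "tends_to (ms \<circ> r) m"
    unfolding tends_to_def
  proof (intro allI impI)
    fix B :: "('i \<Rightarrow> 'a) set" assume "cylinder B"
    then have B: "B \<inter> X \<in> ?M" by auto
    have "measure m (B \<inter> X) = f (B \<inter> X)"
      using em[OF B] f0[OF B] by (simp add: measure_def)
    then show "(\<lambda>k. measure ((ms \<circ> r) k) (B \<inter> X)) \<longlonglongrightarrow> measure m (B \<inter> X)"
      using lim[OF B] by simp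
  qed
  ultimately show ?thesis using r(1) that by blast
qed

end

subsection \<open>Invariant measures and the weak-star topology\<close>

lemma shift_funpow_apply: "(shift ^^ n) x i = x (i + of_nat n)"
  by (induction n arbitrary: i) (simp_all add: shift_def add_ac)

lemma cylinder_vimage_shift:
  assumes "cylinder B"
  shows "cylinder (shift -` B)"
proof -
  obtain F where F: "finite F" "\<forall>x y. (\<forall>i\<in>F. x i = y i) \<longrightarrow> (x \<in> B \<longleftrightarrow> y \<in> B)"
    using assms unfolding cylinder_def by auto
  show ?thesis
  proof (rule cylinderI[of "(\<lambda>i. i + 1) ` F"])
    fix x y :: "'a \<Rightarrow> 'b"
    assume "\<And>i. i \<in> (\<lambda>i. i + 1) ` F \<Longrightarrow> x i = y i" and "x \<in> shift -` B"
    then show "y \<in> shift -` B"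
      using F(2)[rule_format, of "shift x" "shift y"] by (simp add: shift_def)
  qed (use F in simp)
qed

lemma cylinder_vimage_shift_funpow: "cylinder B \<Longrightarrow> cylinder ((shift ^^ n) -` B)"
proof (induction n)
  case (Suc n)
  then show ?case
    using cylinder_vimage_shift[of "(shift ^^ n) -` B"]
    by (simp add: vimage_comp o_def funpow_swap1)
qed simp

lemma continuous_on_shift:
  "continuous_on UNIV (shift :: ('i::linordered_semidom \<Rightarrow> 'a::topological_space) \<Rightarrow> _)"
  unfolding shift_def
  by (intro continuous_on_coordinatewise_then_product continuous_on_product_coordinates)

lemma continuous_on_of_bool_cylinder:
  fixes B :: "('i \<Rightarrow> 'a::discrete_topology) set"
  assumes "cylinder B"
  shows "continuous_on X (\<lambda>x. of_bool (x \<in> B) :: real)"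
proof -
  have "continuous_on (B \<union> - B) (\<lambda>x. if x \<in> B then 1 else 0 :: real)"
    by (rule continuous_on_cases)
       (use assms in \<open>auto simp: closed_cylinder cylinder_Compl\<close>)
  then have "continuous_on UNIV (\<lambda>x. of_bool (x \<in> B) :: real)"
    by (simp add: of_bool_def)
  then show ?thesis by (rule continuous_on_subset) simp
qed

context shift_space
begin

lemma shift_in: "x \<in> X \<Longrightarrow> shift x \<in> X"
  using shift_subset by auto

lemma shift_funpow_in: "x \<in> X \<Longrightarrow> (shift ^^ n) x \<in> X"
  by (induction n) (simp_all add: shift_in)

lemma continuous_on_shift_funpow: "continuous_on X (shift ^^ n)"
proof (induction n)
  case (Suc n)
  have "continuous_on X (shift \<circ> shift ^^ n)"
    by (rule continuous_on_compose[OF Suc continuous_on_subset[OF continuous_on_shift]]) simp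
  then show ?case by simp
qed (simp add: id_def)

lemma borel_measurable_continuous:
  assumes "\<mu> \<in> prob_measures X" "continuous_on X (f :: _ \<Rightarrow> real)"
  shows "f \<in> borel_measurable \<mu>"
  using borel_measurable_continuous_on_restrict[OF assms(2)]
  by (simp add: measurable_cong_sets[OF prob_measuresD(3)[OF assms(1)] refl])

lemma integrable_continuous:
  assumes "\<mu> \<in> prob_measures X" "continuous_on X (f :: _ \<Rightarrow> real)"
  shows "integrable \<mu> f"
proof -
  interpret prob_space \<mu> using assms(1) by (rule prob_measuresD)
  have "bounded (f ` X)"
    by (rule compact_imp_bounded[OF compact_continuous_image[OF assms(2) compact_X]])
  then obtain B where "\<And>x. x \<in> X \<Longrightarrow> norm (f x) \<le> B"
    unfolding bounded_iff by auto
  then show ?thesis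
    by (intro integrable_const_bound[of _ B] borel_measurable_continuous[OF assms] AE_I2)
       (simp add: prob_measuresD[OF assms(1)])
qed

lemma measurable_shift:
  assumes "\<mu> \<in> prob_measures X"
  shows "shift \<in> measurable \<mu> \<mu>"
proof -
  have "shift \<in> measurable (borel :: ('i \<Rightarrow> 'a) measure) borel"
    by (rule borel_measurable_continuous_onI[OF continuous_on_shift])
  then have "shift \<in> measurable (restrict_space borel X) (restrict_space borel X)"
    by (rule measurable_restrict_space3) (use shift_in in auto)
  moreover have "sets \<mu> = sets (restrict_space borel X)"
    using assms by (rule prob_measuresD)
  ultimately show ?thesis
    using measurable_cong_sets by blast
qed

lemma vimage_shift_Int: "shift -` (B \<inter> X) \<inter> X = shift -` B \<inter> X"
  using shift_in by auto

lemma distr_shift_in: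
  assumes "\<mu> \<in> prob_measures X"
  shows "distr \<mu> \<mu> shift \<in> prob_measures X"
  using assms prob_space.prob_space_distr[OF prob_measuresD(1)[OF assms] measurable_shift[OF assms]]
  by (simp add: prob_measures_def)

lemma measure_distr_shift:
  assumes "\<mu> \<in> prob_measures X" "A \<in> sets \<mu>"
  shows "measure (distr \<mu> \<mu> shift) A = measure \<mu> (shift -` A \<inter> X)"
  using measure_distr[OF measurable_shift[OF assms(1)] assms(2)] prob_measuresD(2)[OF assms(1)]
  by simp

text \<open>As an equation between two measures, invariance can be tested on cylinders alone and
  carried over to integrals.\<close>

lemma invariant_iff_distr:
  "\<mu> \<in> invariant_measures X \<longleftrightarrow> \<mu> \<in> prob_measures X \<and> distr \<mu> \<mu> shift = \<mu>"
proof (intro iffI conjI; (elim conjE)?)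
  assume \<mu>: "\<mu> \<in> invariant_measures X"
  then show P: "\<mu> \<in> prob_measures X" by (simp add: invariant_measures_def)
  show "distr \<mu> \<mu> shift = \<mu>"
  proof (rule prob_measures_eqI[OF distr_shift_in[OF P] P])
    show "measure (distr \<mu> \<mu> shift) (B \<inter> X) = measure \<mu> (B \<inter> X)" if "cylinder B" for B
      using \<mu> cylinder_in_sets[OF P that] measure_distr_shift[OF P, of "B \<inter> X"]
      unfolding invariant_measures_def by (simp only: mem_Collect_eq)
  qed
next
  assume "\<mu> \<in> prob_measures X" "distr \<mu> \<mu> shift = \<mu>"
  then show "\<mu> \<in> invariant_measures X"
    unfolding invariant_measures_def using measure_distr_shift[of \<mu>] by simp
qed

lemma invariantI:
  assumes \<mu>: "\<mu> \<in> prob_measures X"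
    and "\<And>B. cylinder B \<Longrightarrow> measure \<mu> (shift -` B \<inter> X) = measure \<mu> (B \<inter> X)"
  shows "\<mu> \<in> invariant_measures X"
  unfolding invariant_iff_distr
proof (intro conjI \<mu> prob_measures_eqI[OF distr_shift_in[OF \<mu>] \<mu>])
  show "measure (distr \<mu> \<mu> shift) (B \<inter> X) = measure \<mu> (B \<inter> X)" if "cylinder B" for B
    using assms(2)[OF that] measure_distr_shift[OF \<mu> cylinder_in_sets[OF \<mu> that]]
    by (simp only: vimage_shift_Int)
qed

lemma invariantD:
  assumes "\<mu> \<in> invariant_measures X" "cylinder B"
  shows "measure \<mu> (shift -` B \<inter> X) = measure \<mu> (B \<inter> X)"
  using assms cylinder_in_sets[of \<mu> B]
  by (auto simp: invariant_measures_def vimage_shift_Int[symmetric, of B])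

text \<open>The preimage of a cylinder under the shift is again a cylinder, so both sides of the
  invariance equation pass to the limit.\<close>

lemma limit_invariant:
  assumes "\<And>k. ms k \<in> invariant_measures X" "m \<in> prob_measures X" "tends_to ms m"
  shows "m \<in> invariant_measures X"
proof (rule invariantI[OF assms(2)])
  fix B :: "('i \<Rightarrow> 'a) set" assume B: "cylinder B"
  have "(\<lambda>k. measure (ms k) (B \<inter> X)) \<longlonglongrightarrow> measure m (shift -` B \<inter> X)"
    using tends_toD[OF assms(3) cylinder_vimage_shift[OF B]] invariantD[OF assms(1) B] by simp
  then show "measure m (shift -` B \<inter> X) = measure m (B \<inter> X)"
    using tends_toD[OF assms(3) B] by (rule LIMSEQ_unique)
qed

lemma integral_shift_funpow:
  assumes \<mu>: "\<mu> \<in> invariant_measures X" and f: "f \<in> borel_measurable \<mu>"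
  shows "(\<integral>x. f ((shift ^^ n) x) \<partial>\<mu>) = (\<integral>x. f x \<partial>\<mu> :: real)"
proof (induction n)
  case (Suc n)
  have P: "\<mu> \<in> prob_measures X" and distr: "distr \<mu> \<mu> shift = \<mu>"
    using \<mu> by (simp_all add: invariant_iff_distr)
  have "(\<lambda>x. f ((shift ^^ n) x)) \<in> borel_measurable \<mu>"
    by (intro measurable_compose[OF measurable_compose_n f] measurable_shift P)
  then have "(\<integral>x. f ((shift ^^ n) x) \<partial>distr \<mu> \<mu> shift) = (\<integral>x. f ((shift ^^ n) (shift x)) \<partial>\<mu>)"
    by (intro integral_distr measurable_shift P)
  then show ?case
    using Suc distr by (simp add: funpow_Suc_right del: funpow.simps)
qed simp

text \<open>Uniform continuity on the compact \<open>X\<close>, with agreement on a finite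
  coordinate set in place of a small distance.\<close>

lemma continuous_uniform_cylinder:
  assumes f: "continuous_on X (f :: _ \<Rightarrow> real)" and e: "e > 0"
  shows "\<exists>F. finite F \<and> (\<forall>x\<in>X. \<forall>y\<in>X. (\<forall>i\<in>F. x i = y i) \<longrightarrow> \<bar>f x - f y\<bar> \<le> e)"
proof -
  have "\<exists>F. finite F \<and> (\<forall>y\<in>X. (\<forall>i\<in>F. y i = x i) \<longrightarrow> \<bar>f y - f x\<bar> < e / 2)" if x: "x \<in> X" for x
  proof -
    have "f x \<in> ball (f x) (e / 2)" using e by simp
    with f x obtain A where A: "open A" "x \<in> A" "\<forall>y\<in>X. y \<in> A \<longrightarrow> f y \<in> ball (f x) (e / 2)"
      unfolding continuous_on_topological by (meson open_ball)
    obtain B where B: "cylinder B" "x \<in> B" "B \<subseteq> A"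
      using open_contains_cylinder[OF A(1,2)] .
    obtain F where F: "finite F" "\<forall>x y. (\<forall>i\<in>F. x i = y i) \<longrightarrow> (x \<in> B \<longleftrightarrow> y \<in> B)"
      using B(1) unfolding cylinder_def by auto
    have "\<bar>f y - f x\<bar> < e / 2" if "y \<in> X" "\<forall>i\<in>F. y i = x i" for y
    proof -
      have "y \<in> A" using F(2)[rule_format, of y x] that(2) B by auto
      then show ?thesis using A(3) that(1) by (auto simp: dist_real_def abs_minus_commute)
    qed
    then show ?thesis using F(1) by blast
  qed
  then obtain F where F: "\<And>x. x \<in> X \<Longrightarrow> finite (F x)"
    "\<And>x y. x \<in> X \<Longrightarrow> y \<in> X \<Longrightarrow> \<forall>i\<in>F x. y i = x i \<Longrightarrow> \<bar>f y - f x\<bar> < e / 2"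
    by metis
  have "open {y. \<forall>i\<in>F x. y i = x i}" if "x \<in> X" for x
    by (rule open_cylinder, rule cylinderI[OF F(1)[OF that]]) auto
  moreover have "X \<subseteq> (\<Union>x\<in>X. {y. \<forall>i\<in>F x. y i = x i})" by auto
  ultimately obtain K where K: "K \<subseteq> X" "finite K" "X \<subseteq> (\<Union>x\<in>K. {y. \<forall>i\<in>F x. y i = x i})"
    by (rule compactE_image[OF compact_X])
  show ?thesis
  proof (intro exI[of _ "\<Union>x\<in>K. F x"] conjI ballI impI)
    show "finite (\<Union>x\<in>K. F x)" using K F(1) by auto
    fix x y assume xy: "x \<in> X" "y \<in> X" "\<forall>i\<in>\<Union>x\<in>K. F x. x i = y i"
    obtain z where z: "z \<in> K" "\<forall>i\<in>F z. x i = z i" using K(3) xy(1) by auto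
    then have "\<forall>i\<in>F z. y i = z i" using xy(3) by fastforce
    then have "\<bar>f y - f z\<bar> < e / 2" using z(1) K(1) xy(2) F(2) by blast
    moreover have "\<bar>f x - f z\<bar> < e / 2" using z K(1) xy(1) F(2) by blast
    ultimately show "\<bar>f x - f y\<bar> \<le> e" by linarith
  qed
qed

text \<open>\<open>f\<close> is replaced by a step function that is constant on each pattern over
  \<open>F\<close>. The same \<open>W\<close> and \<open>g\<close> serve for all measures, which is
  what makes convergence on cylinders sufficient for convergence of integrals.\<close>

lemma integral_cylinder_approx:
  assumes f: "continuous_on X (f :: _ \<Rightarrow> real)" and e: "e > 0"
  shows "\<exists>W g. finite W \<and> (\<forall>B\<in>W. cylinder B) \<and> (\<forall>\<mu>\<in>prob_measures X.
       \<bar>(\<integral>x. f x \<partial>\<mu>) - (\<Sum>B\<in>W. g B * measure \<mu> (B \<inter> X))\<bar> \<le> e)"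
proof -
  obtain F where F: "finite F"
    "\<And>x y. x \<in> X \<Longrightarrow> y \<in> X \<Longrightarrow> \<forall>i\<in>F. x i = y i \<Longrightarrow> \<bar>f x - f y\<bar> \<le> e"
    using continuous_uniform_cylinder[OF f e] by auto
  define C where "C w = {x :: 'i \<Rightarrow> 'a. restrict x F = w}" for w
  define W where "W = C ` (F \<rightarrow>\<^sub>E UNIV)"
  \<comment> \<open>If \<open>B\<close> misses \<open>X\<close>, the chosen point is arbitrary, but
    then the term of \<open>B\<close> carries measure 0.\<close>
  define g where "g B = f (SOME x. x \<in> B \<inter> X)" for B
  have fin: "finite W" unfolding W_def by (intro finite_imageI finite_PiE) (use F in auto)
  have cyl: "cylinder B" if "B \<in> W" for B
  proof -
    obtain w where w: "B = C w" using \<open>B \<in> W\<close> unfolding W_def by auto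
    show ?thesis unfolding w C_def
    proof (rule cylinderI[OF F(1)])
      fix x y :: "'i \<Rightarrow> 'a"
      assume "\<And>i. i \<in> F \<Longrightarrow> x i = y i" "x \<in> {x. restrict x F = w}"
      moreover from this(1) have "restrict x F = restrict y F" by (rule restrict_ext)
      ultimately show "y \<in> {x. restrict x F = w}" by simp
    qed
  qed
  have step: "(\<Sum>B\<in>W. g B * indicator (B \<inter> X) x) = g (C (restrict x F))" if x: "x \<in> X" for x
  proof -
    have "C (restrict x F) \<in> W" unfolding W_def by (rule imageI) auto
    moreover have "(\<Sum>B\<in>W. g B * indicator (B \<inter> X) x) =
        (\<Sum>B\<in>W. if B = C (restrict x F) then g B else 0)"
    proof (intro sum.cong refl)
      fix B assume "B \<in> W"
      then obtain w where w: "B = C w" unfolding W_def by blast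
      have "w = restrict x F" if "C w = C (restrict x F)"
      proof -
        have "x \<in> C (restrict x F)" by (simp only: C_def mem_Collect_eq)
        then have "x \<in> C w" by (simp only: that)
        then show ?thesis by (simp only: C_def mem_Collect_eq)
      qed
      moreover have "x \<in> B \<longleftrightarrow> w = restrict x F"
        by (simp only: w C_def mem_Collect_eq eq_commute[of w])
      ultimately have "x \<in> B \<inter> X \<longleftrightarrow> B = C (restrict x F)" using w x by blast
      then show "g B * indicator (B \<inter> X) x = (if B = C (restrict x F) then g B else 0)"
        by (simp add: indicator_def)
    qed
    ultimately show ?thesis using fin by simp
  qed
  have close: "\<bar>f x - g (C (restrict x F))\<bar> \<le> e" if x: "x \<in> X" for x
  proof -
    define y where "y = (SOME y. y \<in> C (restrict x F) \<inter> X)"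
    have "y \<in> C (restrict x F) \<inter> X"
      unfolding y_def by (rule someI[of _ x]) (use x in \<open>simp only: C_def mem_Collect_eq Int_iff\<close>)
    then have "y \<in> X" "restrict y F = restrict x F" by (auto simp: C_def)
    then have "x i = y i" if "i \<in> F" for i
      using that \<open>restrict y F = restrict x F\<close> by (metis restrict_apply')
    with \<open>y \<in> X\<close> x show ?thesis
      unfolding g_def y_def[symmetric] by (intro F(2)) auto
  qed
  show ?thesis
  proof (intro exI[of _ W] exI[of _ g] conjI ballI)
    fix \<mu> assume \<mu>: "\<mu> \<in> prob_measures X"
    interpret prob_space \<mu> using \<mu> by (rule prob_measuresD)
    have sets: "B \<inter> X \<in> sets \<mu>" if "B \<in> W" for B
      by (rule cylinder_in_sets[OF \<mu> cyl[OF that]])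
    have int1: "integrable \<mu> (\<lambda>x. g B * indicator (B \<inter> X) x)" if "B \<in> W" for B
      using sets[OF that] by (intro integrable_mult_right) (simp add: emeasure_eq_measure)
    then have int: "integrable \<mu> (\<lambda>x. \<Sum>B\<in>W. g B * indicator (B \<inter> X) x)"
      by (rule Bochner_Integration.integrable_sum)
    have "(\<Sum>B\<in>W. g B * measure \<mu> (B \<inter> X)) = (\<Sum>B\<in>W. \<integral>x. g B * indicator (B \<inter> X) x \<partial>\<mu>)"
      using sets by (intro sum.cong) (auto simp: prob_measuresD[OF \<mu>])
    also have "\<dots> = (\<integral>x. (\<Sum>B\<in>W. g B * indicator (B \<inter> X) x) \<partial>\<mu>)"
      by (rule Bochner_Integration.integral_sum[OF int1, symmetric])
    finally have "\<bar>(\<integral>x. f x \<partial>\<mu>) - (\<Sum>B\<in>W. g B * measure \<mu> (B \<inter> X))\<bar> =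
        \<bar>\<integral>x. f x - (\<Sum>B\<in>W. g B * indicator (B \<inter> X) x) \<partial>\<mu>\<bar>"
      using integrable_continuous[OF \<mu> f] int by (simp add: Bochner_Integration.integral_diff)
    also have "\<dots> \<le> (\<integral>x. \<bar>f x - (\<Sum>B\<in>W. g B * indicator (B \<inter> X) x)\<bar> \<partial>\<mu>)"
      by (rule integral_abs_bound)
    also have "\<dots> \<le> (\<integral>x. e \<partial>\<mu>)"
    proof (rule integral_mono)
      show "integrable \<mu> (\<lambda>x. \<bar>f x - (\<Sum>B\<in>W. g B * indicator (B \<inter> X) x)\<bar>)"
        by (intro integrable_abs Bochner_Integration.integrable_diff integrable_continuous[OF \<mu> f] int)
      show "\<bar>f x - (\<Sum>B\<in>W. g B * indicator (B \<inter> X) x)\<bar> \<le> e" if "x \<in> space \<mu>" for x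
      proof -
        have "x \<in> X" using that prob_measuresD(2)[OF \<mu>] by simp
        then show ?thesis unfolding step[OF \<open>x \<in> X\<close>] by (rule close)
      qed
    qed simp
    also have "\<dots> = e" by (simp add: prob_space)
    finally show "\<bar>(\<integral>x. f x \<partial>\<mu>) - (\<Sum>B\<in>W. g B * measure \<mu> (B \<inter> X))\<bar> \<le> e" .
  qed (use fin cyl in auto)
qed

lemma tends_to_integral:
  assumes f: "continuous_on X (f :: _ \<Rightarrow> real)"
    and ms: "\<And>k. ms k \<in> prob_measures X" and m: "m \<in> prob_measures X" and lim: "tends_to ms m"
  shows "(\<lambda>k. \<integral>x. f x \<partial>ms k) \<longlonglongrightarrow> (\<integral>x. f x \<partial>m)"
proof (rule LIMSEQ_I)
  fix r :: real assume "r > 0"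
  then have r: "r / 4 > 0" by simp
  obtain W g where W: "finite W" "\<And>B. B \<in> W \<Longrightarrow> cylinder B"
    "\<And>\<mu>. \<mu> \<in> prob_measures X \<Longrightarrow>
       \<bar>(\<integral>x. f x \<partial>\<mu>) - (\<Sum>B\<in>W. g B * measure \<mu> (B \<inter> X))\<bar> \<le> r / 4"
    using integral_cylinder_approx[OF f r] by blast
  have "(\<lambda>k. \<Sum>B\<in>W. g B * measure (ms k) (B \<inter> X)) \<longlonglongrightarrow> (\<Sum>B\<in>W. g B * measure m (B \<inter> X))"
    by (intro tendsto_sum tendsto_mult_left tends_toD[OF lim] W)
  from LIMSEQ_D[OF this r] obtain N where N: "\<And>k. k \<ge> N \<Longrightarrow>
      norm ((\<Sum>B\<in>W. g B * measure (ms k) (B \<inter> X)) - (\<Sum>B\<in>W. g B * measure m (B \<inter> X))) < r / 4"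
    by blast
  show "\<exists>N. \<forall>k\<ge>N. norm ((\<integral>x. f x \<partial>ms k) - (\<integral>x. f x \<partial>m)) < r"
  proof (intro exI allI impI)
    fix k assume "k \<ge> N"
    from N[OF this] W(3)[OF ms[of k]] W(3)[OF m] \<open>r > 0\<close>
    show "norm ((\<integral>x. f x \<partial>ms k) - (\<integral>x. f x \<partial>m)) < r"
      unfolding real_norm_def by linarith
  qed
qed

text \<open>Convergence of integrals puts the sequence eventually into every generating set that
  contains the limit. Induction over the generation of the topology extends this to every open set
  around the limit, in particular to the complement of \<open>E\<close> if the limit were outside
  \<open>E\<close>.\<close>

lemma weak_star_closed_limit:
  assumes cl: "closedin (weak_star X) E" and ms: "\<And>k. ms k \<in> E"
    and E: "E \<subseteq> prob_measures X" and m: "m \<in> prob_measures X" and lim: "tends_to ms m"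
  shows "m \<in> E"
proof (rule ccontr)
  assume "m \<notin> E"
  let ?S = "{{\<mu> \<in> prob_measures X. integral\<^sup>L \<mu> f \<in> V} | (f :: ('i \<Rightarrow> 'a) \<Rightarrow> real) V.
       continuous_on X f \<and> open V}"
  have ev: "\<forall>\<^sub>F k in sequentially. ms k \<in> G" if "generate_topology_on ?S G" "m \<in> G" for G
    using that
  proof (induction rule: generate_topology_on.induct)
    case (Int a b)
    then show ?case by (auto simp: eventually_conj_iff)
  next
    case (UN K)
    then obtain k where k: "k \<in> K" "m \<in> k" by auto
    have "\<forall>\<^sub>F n in sequentially. ms n \<in> k" using UN.IH[OF k] .
    then show ?case by (rule eventually_mono) (use k in auto)
  next
    case (Basis s)
    then obtain f :: "('i \<Rightarrow> 'a) \<Rightarrow> real" and V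
      where s: "s = {\<mu> \<in> prob_measures X. integral\<^sup>L \<mu> f \<in> V}" "continuous_on X f" "open V" by auto
    have "\<forall>\<^sub>F k in sequentially. integral\<^sup>L (ms k) f \<in> V"
    proof (rule topological_tendstoD[OF _ s(3)])
      show "(\<lambda>k. integral\<^sup>L (ms k) f) \<longlonglongrightarrow> integral\<^sup>L m f"
        using tends_to_integral[OF s(2) _ m lim] ms E by blast
      show "integral\<^sup>L m f \<in> V" using Basis s by auto
    qed
    then show ?case
      by (rule eventually_mono) (use ms E in \<open>auto simp: s(1)\<close>)
  qed simp
  have "openin (weak_star X) (topspace (weak_star X) - E)"
    using cl by (simp add: closedin_def)
  then have gen: "generate_topology_on ?S (topspace (weak_star X) - E)"
    unfolding weak_star_def openin_topology_generated_by_iff .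
  \<comment> \<open>Taking any function and the whole line as \<open>V\<close> makes the set of all
    probability measures a generator, so \<open>m\<close> lies in the space of the topology.\<close>
  have "prob_measures X \<in> ?S"
    by (auto intro!: exI[of _ "\<lambda>_. 0"] exI[of _ UNIV])
  then have "prob_measures X \<subseteq> topspace (weak_star X)"
    unfolding weak_star_def topology_generated_by_topspace by (rule Union_upper)
  then have "m \<in> topspace (weak_star X) - E" using m \<open>m \<notin> E\<close> by auto
  from ev[OF gen this] show False using ms by auto
qed

end

section \<open>Orbit measures and ergodic measures maximizing a cylinder\<close>

context shift_space
begin

text \<open>The push-forward of a pmf is a probability measure for every \<open>N\<close>, including
  \<open>N = 0\<close>, where \<open>pmf_of_set\<close> is unspecified but still a pmf.\<close>

definition empirical :: "('i \<Rightarrow> 'a) \<Rightarrow> nat \<Rightarrow> ('i \<Rightarrow> 'a) measure" where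
  "empirical y N =
    distr (measure_pmf (pmf_of_set {..<N})) (restrict_space borel X) (\<lambda>j. (shift ^^ j) y)"

lemma measurable_orbit:
  "y \<in> X \<Longrightarrow> (\<lambda>j. (shift ^^ j) y) \<in> measurable (measure_pmf p) (restrict_space borel X)"
  by (simp add: shift_funpow_in space_restrict_space)

lemma empirical_in:
  assumes "y \<in> X"
  shows "empirical y N \<in> prob_measures X"
  unfolding prob_measures_def empirical_def
  using measure_pmf.prob_space_distr[OF measurable_orbit[OF assms]]
  by (simp add: space_restrict_space)

lemma measure_empirical:
  assumes y: "y \<in> X" and N: "N > 0" and B: "cylinder B"
  shows "measure (empirical y N) (B \<inter> X) = (\<Sum>j<N. of_bool ((shift ^^ j) y \<in> B)) / real N"
proof -
  have sets: "B \<inter> X \<in> sets (restrict_space borel X)"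
    using cylinder_in_sets[OF empirical_in[OF y] B, of N] by (simp add: empirical_def)
  have "measure (empirical y N) (B \<inter> X) =
      measure (measure_pmf (pmf_of_set {..<N})) {j. (shift ^^ j) y \<in> B}"
    unfolding empirical_def
    by (subst measure_distr[OF measurable_orbit[OF y] sets])
       (auto intro!: arg_cong[where f = "measure _"] simp: shift_funpow_in[OF y])
  also have "\<dots> = real (card ({..<N} \<inter> {j. (shift ^^ j) y \<in> B})) / real N"
    using N by (subst measure_pmf_of_set) (auto simp: lessThan_empty_iff)
  also have "real (card ({..<N} \<inter> {j. (shift ^^ j) y \<in> B})) =
      (\<Sum>j<N. of_bool ((shift ^^ j) y \<in> B))"
    by (simp add: of_bool_def sum.If_cases)
  finally show ?thesis .
qed

text \<open>The Krylov-Bogolyubov argument: along an orbit segment of length N, the frequencies of a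
  cylinder and of its shifted preimage differ by at most 1/N because the difference telescopes. A
  lower bound on the frequency of \<open>B\<close> survives in the limit since \<open>B\<close> is a
  cylinder.\<close>

lemma invariant_of_long_orbits:
  assumes y: "\<And>k. y k \<in> X" and N: "\<And>k. N k \<ge> Suc k" and B: "cylinder B"
    and freq: "\<And>k. (\<Sum>j<N k. of_bool ((shift ^^ j) (y k) \<in> B)) \<ge> e * real (N k)"
  shows "\<exists>m\<in>invariant_measures X. measure m (B \<inter> X) \<ge> e"
proof -
  define ms where "ms k = empirical (y k) (N k)" for k
  have ms: "ms k \<in> prob_measures X" for k unfolding ms_def by (rule empirical_in[OF y])
  have Npos: "N k > 0" for k using N[of k] by simp
  obtain r m where r: "strict_mono r" and m: "m \<in> prob_measures X" and lim: "tends_to (ms \<circ> r) m"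
    using prob_measures_compact[of ms, OF ms] .
  have "m \<in> invariant_measures X"
  proof (rule invariantI[OF m])
    fix A :: "('i \<Rightarrow> 'a) set" assume A: "cylinder A"
    have le: "\<bar>measure (ms k) (shift -` A \<inter> X) - measure (ms k) (A \<inter> X)\<bar> \<le> inverse (real (Suc k))" for k
    proof -
      let ?g = "\<lambda>j. of_bool ((shift ^^ j) (y k) \<in> A) :: real"
      have "measure (ms k) (shift -` A \<inter> X) - measure (ms k) (A \<inter> X)
          = ((\<Sum>j<N k. ?g (Suc j)) - (\<Sum>j<N k. ?g j)) / real (N k)"
        unfolding ms_def measure_empirical[OF y Npos A]
          measure_empirical[OF y Npos cylinder_vimage_shift[OF A]]
        by (simp add: diff_divide_distrib)
      also have "(\<Sum>j<N k. ?g (Suc j)) - (\<Sum>j<N k. ?g j) = ?g (N k) - ?g 0"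
        unfolding sum_subtractf[symmetric] by (rule sum_lessThan_telescope)
      also have "\<bar>(?g (N k) - ?g 0) / real (N k)\<bar> \<le> 1 / real (N k)"
        by (simp add: abs_divide divide_right_mono of_bool_def)
      also have "\<dots> \<le> inverse (real (Suc k))"
        using N[of k] by (simp add: field_simps)
      finally show ?thesis .
    qed
    have "(\<lambda>k. measure (ms k) (shift -` A \<inter> X) - measure (ms k) (A \<inter> X)) \<longlonglongrightarrow> 0"
      by (rule Lim_null_comparison[OF _ LIMSEQ_inverse_real_of_nat])
         (intro always_eventually allI, use le in simp)
    from LIMSEQ_subseq_LIMSEQ[OF this r]
    have "(\<lambda>k. measure ((ms \<circ> r) k) (shift -` A \<inter> X) - measure ((ms \<circ> r) k) (A \<inter> X)) \<longlonglongrightarrow> 0"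
      by (simp add: o_def)
    moreover have "(\<lambda>k. measure ((ms \<circ> r) k) (shift -` A \<inter> X) - measure ((ms \<circ> r) k) (A \<inter> X))
        \<longlonglongrightarrow> measure m (shift -` A \<inter> X) - measure m (A \<inter> X)"
      by (intro tendsto_diff tends_toD[OF lim] A cylinder_vimage_shift)
    ultimately have "measure m (shift -` A \<inter> X) - measure m (A \<inter> X) = 0"
      using LIMSEQ_unique by blast
    then show "measure m (shift -` A \<inter> X) = measure m (A \<inter> X)" by simp
  qed
  moreover have "e \<le> measure m (B \<inter> X)"
  proof (rule LIMSEQ_le_const[OF tends_toD[OF lim B]], intro exI allI impI)
    fix k
    show "e \<le> measure ((ms \<circ> r) k) (B \<inter> X)"
      using freq[of "r k"] Npos[of "r k"]
      unfolding o_apply ms_def measure_empirical[OF y Npos B] by (simp add: pos_le_divide_eq)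
  qed
  ultimately show ?thesis by blast
qed

text \<open>Formulated for a sequentially closed set of measures because it is applied twice in a
  row: to all invariant measures, and then to those among them that give a cylinder its maximal
  measure.\<close>

lemma attains_maximum:
  fixes \<Psi> :: "('i \<Rightarrow> 'a) measure \<Rightarrow> real"
  assumes S: "S \<subseteq> prob_measures X" "S \<noteq> {}"
    and closed: "\<And>ms m. (\<And>k. ms k \<in> S) \<Longrightarrow> m \<in> prob_measures X \<Longrightarrow> tends_to ms m \<Longrightarrow> m \<in> S"
    and bdd: "bdd_above (\<Psi> ` S)"
    and cont: "\<And>ms m. (\<And>k. ms k \<in> S) \<Longrightarrow> m \<in> S \<Longrightarrow> tends_to ms m \<Longrightarrow> (\<lambda>k. \<Psi> (ms k)) \<longlonglongrightarrow> \<Psi> m"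
  shows "\<exists>m\<in>S. \<forall>\<mu>\<in>S. \<Psi> \<mu> \<le> \<Psi> m"
proof -
  let ?s = "Sup (\<Psi> ` S)"
  have "\<exists>\<mu>\<in>S. ?s - inverse (real (Suc k)) < \<Psi> \<mu>" for k
    using less_cSup_iff[of "\<Psi> ` S" "?s - inverse (real (Suc k))"] S(2) bdd by auto
  then obtain ms where ms: "\<And>k. ms k \<in> S" "\<And>k. ?s - inverse (real (Suc k)) < \<Psi> (ms k)"
    by metis
  obtain r m where r: "strict_mono r" and m: "m \<in> prob_measures X" and lim: "tends_to (ms \<circ> r) m"
    using prob_measures_compact[of ms] ms(1) S(1) by blast
  have mS: "m \<in> S" by (rule closed[OF _ m lim]) (simp add: ms)
  have lim1: "(\<lambda>k. \<Psi> ((ms \<circ> r) k)) \<longlonglongrightarrow> \<Psi> m" by (rule cont[OF _ mS lim]) (simp add: ms)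
  have "(\<lambda>k. ?s - inverse (real (Suc (r k)))) \<longlonglongrightarrow> ?s - 0"
    using LIMSEQ_subseq_LIMSEQ[OF LIMSEQ_inverse_real_of_nat r]
    by (intro tendsto_diff tendsto_const) (simp add: o_def)
  then have "?s - 0 \<le> \<Psi> m"
    by (rule LIMSEQ_le[OF _ lim1]) (use ms(2) in \<open>auto intro!: exI[of _ 0] less_imp_le\<close>)
  then have "\<Psi> \<mu> \<le> \<Psi> m" if "\<mu> \<in> S" for \<mu>
    using cSup_upper[OF imageI[OF that] bdd] by linarith
  then show ?thesis using mS by blast
qed

text \<open>As \<open>A\<close> equals its own preimage in \<open>X\<close>, intersecting with
  \<open>A\<close> commutes with taking preimages under the shift.\<close>

lemma conditional_invariant:
  assumes \<mu>: "\<mu> \<in> invariant_measures X" and A: "A \<in> sets \<mu>" "shift -` A \<inter> X = A"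
    and pos: "measure \<mu> A > 0"
  shows "uniform_measure \<mu> A \<in> invariant_measures X"
    and "\<And>B. B \<in> sets \<mu> \<Longrightarrow> measure (uniform_measure \<mu> A) B = measure \<mu> (A \<inter> B) / measure \<mu> A"
proof -
  have P: "\<mu> \<in> prob_measures X" using \<mu> by (simp add: invariant_measures_def)
  interpret prob_space \<mu> using P by (rule prob_measuresD)
  have em: "emeasure \<mu> A \<noteq> 0" "emeasure \<mu> A \<noteq> \<infinity>"
    using pos by (auto simp: emeasure_eq_measure)
  show eq: "\<And>B. B \<in> sets \<mu> \<Longrightarrow> measure (uniform_measure \<mu> A) B = measure \<mu> (A \<inter> B) / measure \<mu> A"
    by (rule measure_uniform_measure[OF em])
  have P': "uniform_measure \<mu> A \<in> prob_measures X"
    using prob_space_uniform_measure[OF em] prob_measuresD[OF P] by (simp add: prob_measures_def)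
  show "uniform_measure \<mu> A \<in> invariant_measures X"
  proof (rule invariantI[OF P'])
    fix B :: "('i \<Rightarrow> 'a) set" assume B: "cylinder B"
    have "A \<inter> (B \<inter> X) \<in> sets \<mu>" using A(1) cylinder_in_sets[OF P B] by blast
    then have "measure \<mu> (shift -` (A \<inter> (B \<inter> X)) \<inter> X) = measure \<mu> (A \<inter> (B \<inter> X))"
      using \<mu> unfolding invariant_measures_def by blast
    moreover have "shift -` (A \<inter> (B \<inter> X)) \<inter> X = A \<inter> (shift -` B \<inter> X)"
      using A(2) shift_in by blast
    ultimately show "measure (uniform_measure \<mu> A) (shift -` B \<inter> X) = measure (uniform_measure \<mu> A) (B \<inter> X)"
      by (simp add: eq cylinder_in_sets[OF P B] cylinder_in_sets[OF P cylinder_vimage_shift[OF B]])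
  qed
qed

text \<open>
  Among the invariant measures maximizing \<open>\<mu> B\<close>, a maximizer of the strictly convex functional
  \<open>\<Phi>\<close> below is extreme, hence ergodic.
\<close>

lemma ergodic_maximizer:
  assumes m: "m \<in> invariant_measures X" and B: "cylinder B"
  shows "\<exists>\<nu>\<in>ergodic_measures X. measure m (B \<inter> X) \<le> measure \<nu> (B \<inter> X)"
proof -
  let ?I = "invariant_measures X"
  have IP: "?I \<subseteq> prob_measures X" by (auto simp: invariant_measures_def)
  have prob_le: "measure \<mu> A \<le> 1" if "\<mu> \<in> ?I" for \<mu> A
  proof -
    interpret prob_space \<mu> using that IP prob_measuresD by blast
    show ?thesis by (rule prob_le_1)
  qed
  have "\<exists>m0\<in>?I. \<forall>\<mu>\<in>?I. measure \<mu> (B \<inter> X) \<le> measure m0 (B \<inter> X)"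
  proof (rule attains_maximum[OF IP])
    show "bdd_above ((\<lambda>\<mu>. measure \<mu> (B \<inter> X)) ` ?I)"
      by (rule bdd_aboveI2[of _ _ 1]) (rule prob_le)
  qed (use m limit_invariant tends_toD[OF _ B] in auto)
  then obtain m0 where m0: "m0 \<in> ?I" "\<And>\<mu>. \<mu> \<in> ?I \<Longrightarrow> measure \<mu> (B \<inter> X) \<le> measure m0 (B \<inter> X)"
    by blast
  define S where "S = {\<mu> \<in> ?I. measure \<mu> (B \<inter> X) = measure m0 (B \<inter> X)}"
  define c where "c = from_nat_into {A :: ('i \<Rightarrow> 'a) set. cylinder A}"
  have c: "cylinder (c n)" for n
    using from_nat_into[of "{A :: ('i \<Rightarrow> 'a) set. cylinder A}" n] cylinder_UNIV unfolding c_def by blast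
  \<comment> \<open>The cylinders are enumerated, so these terms determine the measure. The
    geometric weights give the domination needed to exchange limit and sum, hence continuity of
    \<open>\<Phi>\<close>.\<close>
  define t where "t \<mu> n = (1/2)^n * (measure \<mu> (c n \<inter> X))\<^sup>2" for \<mu> n
  define \<Phi> where "\<Phi> \<mu> = (\<Sum>n. t \<mu> n)" for \<mu>
  have t_le: "norm (t \<mu> n) \<le> (1/2)^n" if "\<mu> \<in> ?I" for \<mu> n
    using power_le_one[OF _ prob_le[OF that], of "c n \<inter> X" 2] unfolding t_def
    by (simp add: mult_left_le)
  have summ: "summable (t \<mu>)" if "\<mu> \<in> ?I" for \<mu>
    by (rule summable_comparison_test'[OF summable_geometric[of "1/2::real"] t_le[OF that]]) simp
  have "\<exists>\<nu>\<in>S. \<forall>\<mu>\<in>S. \<Phi> \<mu> \<le> \<Phi> \<nu>"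
  proof (rule attains_maximum)
    show "S \<subseteq> prob_measures X" "S \<noteq> {}" using m0(1) IP by (auto simp: S_def)
    show "\<mu> \<in> S" if "\<And>k. ms k \<in> S" "\<mu> \<in> prob_measures X" "tends_to ms \<mu>" for ms \<mu>
    proof -
      have "\<mu> \<in> ?I" by (rule limit_invariant[OF _ that(2,3)]) (use that(1) S_def in auto)
      moreover have "(\<lambda>k. measure (ms k) (B \<inter> X)) = (\<lambda>k. measure m0 (B \<inter> X))"
        using that(1) by (auto simp: S_def)
      then have "measure \<mu> (B \<inter> X) = measure m0 (B \<inter> X)"
        using tends_toD[OF that(3) B] by (simp add: LIMSEQ_const_iff)
      ultimately show ?thesis by (simp add: S_def)
    qed
    show "bdd_above (\<Phi> ` S)"
    proof (rule bdd_aboveI2)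
      fix \<mu> assume "\<mu> \<in> S"
      then have \<mu>: "\<mu> \<in> ?I" by (simp add: S_def)
      show "\<Phi> \<mu> \<le> (\<Sum>n. (1/2)^n)"
        unfolding \<Phi>_def using t_le[OF \<mu>] by (intro suminf_le summ \<mu> summable_geometric) (auto simp: abs_le_iff)
    qed
    show "(\<lambda>k. \<Phi> (ms k)) \<longlonglongrightarrow> \<Phi> \<mu>" if "\<And>k. ms k \<in> S" "\<mu> \<in> S" "tends_to ms \<mu>" for ms \<mu>
      unfolding \<Phi>_def
    proof (rule tannerys_theorem[THEN conjunct2, THEN conjunct2])
      show "(\<lambda>k. t (ms k) n) \<longlonglongrightarrow> t \<mu> n" for n
        unfolding t_def by (intro tendsto_mult_left tendsto_power tends_toD[OF that(3) c])
      show "\<forall>\<^sub>F (n, k) in sequentially \<times>\<^sub>F sequentially. norm (t (ms k) n) \<le> (1/2)^n"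
        using that(1) t_le by (intro always_eventually) (auto simp: S_def)
    qed (auto intro!: summable_geometric)
  qed
  then obtain \<nu> where \<nu>: "\<nu> \<in> S" "\<And>\<mu>. \<mu> \<in> S \<Longrightarrow> \<Phi> \<mu> \<le> \<Phi> \<nu>" by blast
  have \<nu>I: "\<nu> \<in> ?I" and \<nu>B: "measure \<nu> (B \<inter> X) = measure m0 (B \<inter> X)"
    using \<nu>(1) by (auto simp: S_def)
  then have \<nu>P: "\<nu> \<in> prob_measures X" using IP by blast
  interpret \<nu>: prob_space \<nu> using \<nu>P by (rule prob_measuresD)
  have "measure \<nu> A = 0 \<or> measure \<nu> A = 1" if A: "A \<in> sets \<nu>" "shift -` A \<inter> X = A" for A
  proof (rule ccontr)
    assume not01: "\<not> (measure \<nu> A = 0 \<or> measure \<nu> A = 1)"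
    define p where "p = measure \<nu> A"
    have p: "0 < p" "p < 1" using not01 \<nu>.prob_le_1[of A] by (auto simp: p_def zero_less_measure_iff order_less_le)
    have A': "X - A \<in> sets \<nu>" "shift -` (X - A) \<inter> X = X - A"
      using A sets.compl_sets[OF A(1)] shift_in by (auto simp: prob_measuresD(2)[OF \<nu>P])
    have mA': "measure \<nu> (X - A) = 1 - p"
      using \<nu>.prob_compl[OF A(1)] by (simp add: p_def prob_measuresD(2)[OF \<nu>P])
    \<comment> \<open>A nontrivial invariant set splits \<open>\<nu>\<close> into a proper convex
      combination of two invariant measures, which live on disjoint sets.\<close>
    define \<alpha> where "\<alpha> = uniform_measure \<nu> A"
    define \<beta> where "\<beta> = uniform_measure \<nu> (X - A)"
    have \<alpha>: "\<alpha> \<in> ?I" "\<And>C. C \<in> sets \<nu> \<Longrightarrow> measure \<alpha> C = measure \<nu> (A \<inter> C) / p"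
      using conditional_invariant[OF \<nu>I A] p(1) by (simp_all add: \<alpha>_def p_def)
    have \<beta>: "\<beta> \<in> ?I" "\<And>C. C \<in> sets \<nu> \<Longrightarrow> measure \<beta> C = measure \<nu> ((X - A) \<inter> C) / (1 - p)"
      using conditional_invariant[OF \<nu>I A'] p(2) mA' by (simp_all add: \<beta>_def)
    have split: "measure \<nu> C = p * measure \<alpha> C + (1 - p) * measure \<beta> C" if C: "C \<in> sets \<nu>" for C
    proof -
      have "C = (A \<inter> C) \<union> ((X - A) \<inter> C)"
        using sets.sets_into_space[OF C] prob_measuresD(2)[OF \<nu>P] by auto
      then have "measure \<nu> C = measure \<nu> ((A \<inter> C) \<union> ((X - A) \<inter> C))" by simp
      also have "\<dots> = measure \<nu> (A \<inter> C) + measure \<nu> ((X - A) \<inter> C)"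
        by (rule \<nu>.finite_measure_Union) (use A A' C in auto)
      finally show ?thesis using p by (simp add: \<alpha>(2)[OF C] \<beta>(2)[OF C])
    qed
    have BX: "B \<inter> X \<in> sets \<nu>" by (rule cylinder_in_sets[OF \<nu>P B])
    \<comment> \<open>Neither half exceeds the maximum and their weighted mean equals it, so both
      halves attain it.\<close>
    have "measure \<alpha> (B \<inter> X) = measure m0 (B \<inter> X) \<and> measure \<beta> (B \<inter> X) = measure m0 (B \<inter> X)"
    proof -
      let ?a = "measure \<alpha> (B \<inter> X)" and ?b = "measure \<beta> (B \<inter> X)" and ?s = "measure m0 (B \<inter> X)"
      have "?a \<le> ?s" "?b \<le> ?s" using m0(2) \<alpha>(1) \<beta>(1) by auto
      then have "p * (?s - ?a) \<ge> 0" "(1 - p) * (?s - ?b) \<ge> 0" using p by auto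
      moreover have "p * (?s - ?a) + (1 - p) * (?s - ?b) = 0"
        using split[OF BX] \<nu>B by (simp add: algebra_simps)
      ultimately have "p * (?s - ?a) = 0" "(1 - p) * (?s - ?b) = 0" by linarith+
      then show ?thesis using p by simp
    qed
    then have "\<alpha> \<in> S" "\<beta> \<in> S" using \<alpha>(1) \<beta>(1) by (auto simp: S_def)
    then have le: "\<Phi> \<alpha> \<le> \<Phi> \<nu>" "\<Phi> \<beta> \<le> \<Phi> \<nu>" using \<nu>(2) by auto
    \<comment> \<open>The convexity defect of the n-th term: for \<open>c = p a + (1 - p) b\<close>,
      the number \<open>p a^2 + (1 - p) b^2 - c^2\<close> equals \<open>p (1 - p) (a - b)^2\<close>.
      Maximality of \<open>\<Phi>\<close> at \<open>\<nu>\<close> forces all defects to vanish, so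
      the two halves agree on every cylinder.\<close>
    define d where "d n = p * t \<alpha> n + (1 - p) * t \<beta> n - t \<nu> n" for n
    have d_eq: "d n = (1/2)^n * (p * (1 - p) * (measure \<alpha> (c n \<inter> X) - measure \<beta> (c n \<inter> X))\<^sup>2)" for n
      unfolding d_def t_def split[OF cylinder_in_sets[OF \<nu>P c]] by algebra
    have d_nonneg: "d n \<ge> 0" for n unfolding d_eq using p by simp
    have d_sums: "d sums (p * \<Phi> \<alpha> + (1 - p) * \<Phi> \<beta> - \<Phi> \<nu>)"
      unfolding d_def \<Phi>_def
      by (intro sums_diff sums_add sums_mult summable_sums summ \<alpha> \<beta> \<nu>I)
    have "p * \<Phi> \<alpha> + (1 - p) * \<Phi> \<beta> \<le> p * \<Phi> \<nu> + (1 - p) * \<Phi> \<nu>"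
      using p le by (intro add_mono mult_left_mono) auto
    then have "suminf d \<le> 0" using sums_unique[OF d_sums] by (simp add: algebra_simps)
    moreover have "0 \<le> suminf d" by (rule suminf_nonneg[OF sums_summable[OF d_sums] d_nonneg])
    ultimately have "suminf d = 0" by simp
    then have "\<forall>n. d n = 0"
      using suminf_eq_zero_iff[OF sums_summable[OF d_sums] d_nonneg] by simp
    then have eq: "measure \<alpha> (c n \<inter> X) = measure \<beta> (c n \<inter> X)" for n
      using p by (simp add: d_eq)
    have "\<alpha> = \<beta>"
    proof (rule prob_measures_eqI)
      show "\<alpha> \<in> prob_measures X" "\<beta> \<in> prob_measures X" using \<alpha>(1) \<beta>(1) IP by auto
      fix C :: "('i \<Rightarrow> 'a) set" assume "cylinder C"
      then obtain n where "c n = C"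
        using from_nat_into_surj[OF countable_cylinders, of C] unfolding c_def by auto
      then show "measure \<alpha> (C \<inter> X) = measure \<beta> (C \<inter> X)" using eq[of n] by simp
    qed
    moreover have "measure \<alpha> A = 1" using \<alpha>(2)[OF A(1)] p by (simp add: p_def)
    moreover have "(X - A) \<inter> A = {}" by blast
    then have "measure \<beta> A = 0" using \<beta>(2)[OF A(1)] by simp
    ultimately show False by simp
  qed
  then have "\<nu> \<in> ergodic_measures X" using \<nu>I by (simp add: ergodic_measures_def)
  moreover have "measure m (B \<inter> X) \<le> measure \<nu> (B \<inter> X)" using m0(2)[OF m] \<nu>B by simp
  ultimately show ?thesis by (rule bexI[rotated])
qed

end

subsection \<open>The ergodic theorem\<close>

definition orbit_sum :: "(('i::linordered_semidom \<Rightarrow> 'a) \<Rightarrow> real) \<Rightarrow> nat \<Rightarrow> ('i \<Rightarrow> 'a) \<Rightarrow> real" where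
  "orbit_sum f n x = (\<Sum>j<n. f ((shift ^^ j) x))"

lemma orbit_sum_Suc_shift: "orbit_sum f (Suc n) x = f x + orbit_sum f n (shift x)"
  unfolding orbit_sum_def
  by (subst sum.lessThan_Suc_shift) (simp add: funpow_Suc_right del: funpow.simps)

text \<open>The recursion computes the maximum of \<open>orbit_sum f k x\<close> over \<open>k \<le> n\<close>.\<close>

fun maximal_sum :: "(('i::linordered_semidom \<Rightarrow> 'a) \<Rightarrow> real) \<Rightarrow> nat \<Rightarrow> ('i \<Rightarrow> 'a) \<Rightarrow> real" where
  "maximal_sum f 0 x = 0"
| "maximal_sum f (Suc n) x = max 0 (f x + maximal_sum f n (shift x))"

lemma maximal_sum_nonneg: "0 \<le> maximal_sum f n x"
  by (cases n) auto

lemma maximal_sum_mono_Suc: "maximal_sum f n x \<le> maximal_sum f (Suc n) x"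
proof (induction n arbitrary: x)
  case (Suc n)
  have "f x + maximal_sum f n (shift x) \<le> f x + maximal_sum f (Suc n) (shift x)"
    using Suc by simp
  then show ?case unfolding maximal_sum.simps(2)[of f n x] maximal_sum.simps(2)[of f "Suc n" x]
    by (intro max.mono) auto
qed simp

lemma maximal_sum_mono: "m \<le> n \<Longrightarrow> maximal_sum f m x \<le> maximal_sum f n x"
  by (rule lift_Suc_mono_le[of "\<lambda>n. maximal_sum f n x"]) (rule maximal_sum_mono_Suc)

lemma orbit_sum_le_maximal_sum: "orbit_sum f n x \<le> maximal_sum f n x"
proof (induction n arbitrary: x)
  case (Suc n)
  show ?case using Suc[of "shift x"] by (simp add: orbit_sum_Suc_shift)
qed (simp add: orbit_sum_def)

text \<open>Where the maximum is positive it starts with the term \<open>f x\<close>, and the rest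
  is at most the maximum at the shifted point. Elsewhere the maximum is 0 and the left side cannot
  be positive.\<close>

lemma maximal_sum_diff_le:
  "maximal_sum f n x - maximal_sum f n (shift x) \<le> f x * of_bool (0 < maximal_sum f n x)"
proof (cases n)
  case (Suc m)
  show ?thesis
  proof (cases "0 < maximal_sum f n x")
    case True
    then have "maximal_sum f n x = f x + maximal_sum f m (shift x)" by (simp add: Suc max_def split: if_splits)
    moreover have "maximal_sum f m (shift x) \<le> maximal_sum f n (shift x)"
      unfolding Suc by (rule maximal_sum_mono_Suc)
    ultimately show ?thesis using True by simp
  next
    case False
    then show ?thesis using maximal_sum_nonneg[of f n x] maximal_sum_nonneg[of f n "shift x"] by simp
  qed
qed simp

section \<open>Maximal and pointwise ergodic theorems for continuous functions\<close>

context shift_space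
begin

lemma continuous_on_comp_shift:
  assumes "continuous_on X (f :: _ \<Rightarrow> real)"
  shows "continuous_on X (\<lambda>x. f ((shift ^^ n) x))"
  using shift_funpow_in
  by (intro continuous_on_compose2[OF assms continuous_on_shift_funpow]) auto

lemma continuous_on_orbit_sum:
  "continuous_on X f \<Longrightarrow> continuous_on X (orbit_sum f n)"
  unfolding orbit_sum_def by (intro continuous_on_sum continuous_on_comp_shift)

lemma continuous_on_maximal_sum:
  assumes "continuous_on X f"
  shows "continuous_on X (maximal_sum f n)"
proof (induction n)
  case (Suc n)
  have "continuous_on X (\<lambda>x. maximal_sum f n (shift x))"
    using continuous_on_comp_shift[OF Suc, of 1] by simp
  then show ?case by (simp add: assms continuous_on_max continuous_on_add)
qed simp

lemma continuous_bounded: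
  assumes "continuous_on X (f :: _ \<Rightarrow> real)"
  obtains K where "K \<ge> 0" "\<forall>x\<in>X. \<bar>f x\<bar> \<le> K"
proof -
  have "bounded (f ` X)"
    by (rule compact_imp_bounded[OF compact_continuous_image[OF assms compact_X]])
  then obtain B where "B > 0" "\<forall>x\<in>X. norm (f x) \<le> B"
    unfolding bounded_pos by auto
  then show ?thesis by (intro that[of B]) auto
qed

lemma integral_continuous_shift:
  assumes "\<mu> \<in> invariant_measures X" "continuous_on X f"
  shows "(\<integral>x. f ((shift ^^ n) x) \<partial>\<mu>) = (\<integral>x. f x \<partial>\<mu> :: real)"
  using assms by (intro integral_shift_funpow borel_measurable_continuous) (auto simp: invariant_measures_def)

text \<open>Garsia's proof of the maximal ergodic theorem.\<close>

lemma maximal_ergodic: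
  assumes \<mu>: "\<mu> \<in> invariant_measures X" and f: "continuous_on X f"
    and ae: "AE x in \<mu>. \<exists>n. orbit_sum f n x > 0"
  shows "0 \<le> (\<integral>x. f x \<partial>\<mu>)"
proof -
  have P: "\<mu> \<in> prob_measures X" using \<mu> by (simp add: invariant_measures_def)
  interpret prob_space \<mu> using P by (rule prob_measuresD)
  obtain K where K: "K \<ge> 0" "\<forall>x\<in>X. \<bar>f x\<bar> \<le> K" using continuous_bounded[OF f] .
  let ?g = "\<lambda>n x. f x * of_bool (0 < maximal_sum f n x)"
  have meas[measurable]: "maximal_sum f n \<in> borel_measurable \<mu>" "f \<in> borel_measurable \<mu>" for n
    by (intro borel_measurable_continuous[OF P] continuous_on_maximal_sum f)+
  have g_meas: "?g n \<in> borel_measurable \<mu>" for n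
    by measurable
  have bound: "norm (?g n x) \<le> K" if "x \<in> X" for n x
    using K that by (auto simp: of_bool_def)
  have g_ae: "AE x in \<mu>. norm (?g n x) \<le> K" for n
    by (rule AE_I2, rule bound) (simp add: prob_measuresD(2)[OF P])
  have g_int: "integrable \<mu> (?g n)" for n
    by (rule integrable_const_bound[OF g_ae g_meas])
  have nonneg: "0 \<le> (\<integral>x. ?g n x \<partial>\<mu>)" for n
  proof -
    have c: "continuous_on X (maximal_sum f n)" by (rule continuous_on_maximal_sum[OF f])
    have c': "continuous_on X (\<lambda>x. maximal_sum f n (shift x))"
      using continuous_on_comp_shift[OF c, of 1] by simp
    \<comment> \<open>Both integrals agree by invariance, so the pointwise inequality for the
      difference gives a sign after integration.\<close>
    have "0 = (\<integral>x. maximal_sum f n x \<partial>\<mu>) - (\<integral>x. maximal_sum f n (shift x) \<partial>\<mu>)"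
      using integral_continuous_shift[OF \<mu> c, of 1] by simp
    also have "\<dots> = (\<integral>x. maximal_sum f n x - maximal_sum f n (shift x) \<partial>\<mu>)"
      by (rule Bochner_Integration.integral_diff[symmetric]; rule integrable_continuous[OF P]) (rule c c')+
    also have "\<dots> \<le> (\<integral>x. ?g n x \<partial>\<mu>)"
      by (intro integral_mono g_int Bochner_Integration.integrable_diff integrable_continuous[OF P] c c' maximal_sum_diff_le)
    finally show ?thesis .
  qed
  \<comment> \<open>At almost every point the maximal sum is positive from some n on, so the
    truncation disappears in the limit.\<close>
  have "(\<lambda>n. \<integral>x. ?g n x \<partial>\<mu>) \<longlonglongrightarrow> (\<integral>x. f x \<partial>\<mu>)"
  proof (rule integral_dominated_convergence[where w = "\<lambda>_. K"])
    show "AE x in \<mu>. (\<lambda>n. ?g n x) \<longlonglongrightarrow> f x"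
      using ae
    proof eventually_elim
      case (elim x)
      then obtain m where m: "orbit_sum f m x > 0" ..
      have "?g n x = f x" if "n \<ge> m" for n
        using m orbit_sum_le_maximal_sum[of f m x] maximal_sum_mono[OF that, of f x] by simp
      then show ?case
        by (intro tendsto_eventually eventually_sequentiallyI[of m])
    qed
  qed (use g_meas g_ae in auto)
  then show ?thesis by (rule LIMSEQ_le_const) (use nonneg in auto)
qed

text \<open>
  The set where the orbit sums of \<open>f\<close> are unbounded above is strictly invariant; if it had full
  measure, the maximal ergodic theorem would contradict the negative mean.
\<close>

lemma ergodic_orbit_sum_bounded:
  assumes \<mu>: "\<mu> \<in> ergodic_measures X" and f: "continuous_on X f" and neg: "(\<integral>x. f x \<partial>\<mu>) < 0"
  shows "AE x in \<mu>. \<exists>K. \<forall>n. orbit_sum f n x \<le> K"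
proof -
  have I: "\<mu> \<in> invariant_measures X" using \<mu> by (simp add: ergodic_measures_def)
  then have P: "\<mu> \<in> prob_measures X" by (simp add: invariant_measures_def)
  interpret prob_space \<mu> using P by (rule prob_measuresD)
  have sp: "space \<mu> = X" using P by (rule prob_measuresD)
  define D where "D = {x \<in> X. \<forall>k::nat. \<exists>n. orbit_sum f n x > real k}"
  have [measurable]: "orbit_sum f n \<in> borel_measurable \<mu>" for n
    by (intro borel_measurable_continuous[OF P] continuous_on_orbit_sum f)
  have D: "D \<in> sets \<mu>"
    unfolding D_def sp[symmetric] by measurable
  \<comment> \<open>Passing from x to its shift removes the single term \<open>f x\<close>, which
    does not affect unboundedness. An empty sum is 0 and exceeds no natural number, so there is
    always a first term to remove.\<close>
  have D_iff: "shift x \<in> D \<longleftrightarrow> x \<in> D" if x: "x \<in> X" for x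
  proof
    assume "shift x \<in> D"
    then have *: "\<exists>n. orbit_sum f n (shift x) > real k" for k by (simp add: D_def)
    have "\<exists>n. orbit_sum f n x > real k" for k
    proof -
      obtain l :: nat where l: "real k - f x < real l" using reals_Archimedean2 by blast
      obtain n where "orbit_sum f n (shift x) > real l" using * by blast
      then have "orbit_sum f (Suc n) x > real k" using l by (simp add: orbit_sum_Suc_shift)
      then show ?thesis ..
    qed
    then show "x \<in> D" using x by (simp add: D_def)
  next
    assume "x \<in> D"
    then have *: "\<exists>n. orbit_sum f n x > real k" for k by (simp add: D_def)
    have "\<exists>n. orbit_sum f n (shift x) > real k" for k
    proof -
      obtain l :: nat where l: "real k + f x < real l" using reals_Archimedean2 by blast
      obtain n where n: "orbit_sum f n x > real l" using * by blast
      then have "n \<noteq> 0" by (intro notI) (simp add: orbit_sum_def)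
      then obtain m where "n = Suc m" using not0_implies_Suc by blast
      then have "orbit_sum f m (shift x) > real k" using n l by (simp add: orbit_sum_Suc_shift)
      then show ?thesis ..
    qed
    then show "shift x \<in> D" using shift_in[OF x] by (simp add: D_def)
  qed
  have "D \<subseteq> X" by (auto simp: D_def)
  then have "shift -` D \<inter> X = D" using D_iff by blast
  then have "prob D = 0 \<or> prob D = 1" using \<mu> D unfolding ergodic_measures_def by blast
  moreover have "prob D \<noteq> 1"
  proof
    assume "prob D = 1"
    then have "AE x in \<mu>. x \<in> D" using D by (simp add: prob_eq_1)
    then have "AE x in \<mu>. \<exists>n. orbit_sum f n x > 0"
    proof eventually_elim
      case (elim x)
      then have "\<exists>n. orbit_sum f n x > real 0" unfolding D_def by blast
      then show ?case by simp
    qed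
    from maximal_ergodic[OF I f this] neg show False by simp
  qed
  ultimately have "AE x in \<mu>. x \<notin> D" using D by (simp add: prob_eq_0)
  then show ?thesis
    using AE_space
  proof eventually_elim
    case (elim x)
    then obtain k where "\<And>n. orbit_sum f n x \<le> real k" by (auto simp: D_def sp not_less)
    then show ?case by blast
  qed
qed

text \<open>Subtracting slightly more than the mean makes the mean negative, and bounded orbit sums
  of the difference are a linear bound on those of \<open>f\<close>. The margins 1/(k+1) suffice, so
  only countably many null sets are discarded.\<close>

lemma ergodic_averages_upper:
  assumes \<mu>: "\<mu> \<in> ergodic_measures X" and f: "continuous_on X f"
  shows "AE x in \<mu>. \<forall>e>0. \<exists>K. \<forall>n. orbit_sum f n x \<le> ((\<integral>x. f x \<partial>\<mu>) + e) * real n + K"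
proof -
  let ?a = "\<integral>x. f x \<partial>\<mu>"
  have P: "\<mu> \<in> prob_measures X" using \<mu> by (simp add: ergodic_measures_def invariant_measures_def)
  interpret prob_space \<mu> using P by (rule prob_measuresD)
  have "AE x in \<mu>. \<exists>K. \<forall>n. orbit_sum (\<lambda>x. f x - (?a + 1 / real (Suc k))) n x \<le> K" for k
  proof (rule ergodic_orbit_sum_bounded[OF \<mu>])
    show "continuous_on X (\<lambda>x. f x - (?a + 1 / real (Suc k)))"
      by (intro continuous_on_diff f continuous_on_const)
    have "(\<integral>x. f x - (?a + 1 / real (Suc k)) \<partial>\<mu>) = ?a - (?a + 1 / real (Suc k))"
      by (subst Bochner_Integration.integral_diff) (simp_all add: integrable_continuous[OF P f] prob_space)
    then show "(\<integral>x. f x - (?a + 1 / real (Suc k)) \<partial>\<mu>) < 0" by simp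
  qed
  then have "AE x in \<mu>. \<forall>k. \<exists>K. \<forall>n. orbit_sum (\<lambda>x. f x - (?a + 1 / real (Suc k))) n x \<le> K"
    by (simp add: AE_all_countable)
  then show ?thesis
  proof eventually_elim
    case (elim x)
    show ?case
    proof (intro allI impI)
      fix e :: real assume "e > 0"
      then obtain k where k: "1 / real (Suc k) < e" using nat_approx_posE by auto
      from elim obtain K where K: "\<And>n. orbit_sum (\<lambda>x. f x - (?a + 1 / real (Suc k))) n x \<le> K" by blast
      have "orbit_sum f n x \<le> (?a + e) * real n + K" for n
      proof -
        have "orbit_sum (\<lambda>x. f x - (?a + 1 / real (Suc k))) n x
            = orbit_sum f n x - (?a + 1 / real (Suc k)) * real n"
          unfolding orbit_sum_def sum_subtractf by simp
        then have "orbit_sum f n x \<le> (?a + 1 / real (Suc k)) * real n + K" using K[of n] by linarith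
        also have "\<dots> \<le> (?a + e) * real n + K"
          using k by (intro add_right_mono mult_right_mono) auto
        finally show ?thesis .
      qed
      then show "\<exists>K. \<forall>n. orbit_sum f n x \<le> (?a + e) * real n + K" by blast
    qed
  qed
qed

text \<open>The upper bounds for \<open>f\<close> and for its negative enclose the average, and the
  additive constants vanish after division by n.\<close>

lemma ergodic_averages:
  assumes \<mu>: "\<mu> \<in> ergodic_measures X" and f: "continuous_on X f"
  shows "AE x in \<mu>. (\<lambda>n. orbit_sum f n x / real n) \<longlonglongrightarrow> (\<integral>x. f x \<partial>\<mu>)"
proof -
  let ?a = "\<integral>x. f x \<partial>\<mu>"
  have neg: "continuous_on X (\<lambda>x. - f x)" by (intro continuous_on_minus f)
  have "AE x in \<mu>. \<forall>e>0. \<exists>K. \<forall>n. - orbit_sum f n x \<le> (- ?a + e) * real n + K"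
    using ergodic_averages_upper[OF \<mu> neg] by (simp add: orbit_sum_def sum_negf)
  with ergodic_averages_upper[OF \<mu> f] show ?thesis
  proof eventually_elim
    case (elim x)
    show ?case
    proof (rule LIMSEQ_I)
      fix e :: real assume "e > 0"
      then have e: "e / 2 > 0" by simp
      obtain K1 where K1: "\<And>n. orbit_sum f n x \<le> (?a + e/2) * real n + K1"
        using elim(1) e by blast
      obtain K2 where K2: "\<And>n. - orbit_sum f n x \<le> (- ?a + e/2) * real n + K2"
        using elim(2) e by blast
      obtain N :: nat where N: "2 * (\<bar>K1\<bar> + \<bar>K2\<bar>) / e < real N" using reals_Archimedean2 by blast
      show "\<exists>N. \<forall>n\<ge>N. norm (orbit_sum f n x / real n - ?a) < e"
      proof (intro exI allI impI)
        fix n assume n: "n \<ge> Suc N"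
        then have "real N < real n" by simp
        then have "2 * (\<bar>K1\<bar> + \<bar>K2\<bar>) / e < real n" using N by linarith
        then have Ke: "\<bar>K1\<bar> + \<bar>K2\<bar> < e / 2 * real n" using \<open>e > 0\<close> by (simp add: field_simps)
        have npos: "real n > 0" using n by simp
        have "\<bar>orbit_sum f n x - ?a * real n\<bar> < e * real n"
          using K1[of n] K2[of n] Ke unfolding abs_less_iff distrib_right mult_minus_left by linarith
        then show "norm (orbit_sum f n x / real n - ?a) < e"
          using npos by (simp add: abs_less_iff field_simps)
      qed
    qed
  qed
qed

text \<open>The mean ergodic theorem, obtained here from the pointwise one by dominated convergence,
  since averages of a bounded function share its bound.\<close>

lemma ergodic_variance:
  assumes \<mu>: "\<mu> \<in> ergodic_measures X" and f: "continuous_on X f"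
  shows "(\<lambda>n. \<integral>x. (orbit_sum f n x / real n - (\<integral>x. f x \<partial>\<mu>))\<^sup>2 \<partial>\<mu>) \<longlonglongrightarrow> 0"
proof -
  let ?a = "\<integral>x. f x \<partial>\<mu>"
  have P: "\<mu> \<in> prob_measures X" using \<mu> by (simp add: ergodic_measures_def invariant_measures_def)
  interpret prob_space \<mu> using P by (rule prob_measuresD)
  obtain K where K: "K \<ge> 0" "\<forall>x\<in>X. \<bar>f x\<bar> \<le> K" using continuous_bounded[OF f] .
  have [measurable]: "orbit_sum f n \<in> borel_measurable \<mu>" for n
    by (intro borel_measurable_continuous[OF P] continuous_on_orbit_sum f)
  have avg: "\<bar>orbit_sum f n x / real n\<bar> \<le> K" if "x \<in> X" for n x
  proof -
    have "\<bar>orbit_sum f n x\<bar> \<le> (\<Sum>j<n. \<bar>f ((shift ^^ j) x)\<bar>)"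
      unfolding orbit_sum_def by (rule sum_abs)
    also have "\<dots> \<le> (\<Sum>j<n. K)" using K(2) shift_funpow_in[OF that] by (intro sum_mono) auto
    finally show ?thesis using K(1) by (cases "n = 0") (simp_all add: abs_divide field_simps)
  qed
  have "(\<lambda>n. \<integral>x. (orbit_sum f n x / real n - ?a)\<^sup>2 \<partial>\<mu>) \<longlonglongrightarrow> (\<integral>x. 0 \<partial>\<mu>)"
  proof (rule integral_dominated_convergence[where w = "\<lambda>_. (K + \<bar>?a\<bar>)\<^sup>2"])
    show "AE x in \<mu>. (\<lambda>n. (orbit_sum f n x / real n - ?a)\<^sup>2) \<longlonglongrightarrow> 0"
      using ergodic_averages[OF \<mu> f]
    proof eventually_elim
      case (elim x)
      from tendsto_power[OF tendsto_diff[OF elim tendsto_const[of ?a]], of 2] show ?case by simp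
    qed
    show "AE x in \<mu>. norm ((orbit_sum f n x / real n - ?a)\<^sup>2) \<le> (K + \<bar>?a\<bar>)\<^sup>2" for n
      using AE_space
    proof eventually_elim
      case (elim x)
      then have "x \<in> X" by (simp add: prob_measuresD(2)[OF P])
      from avg[OF this, of n] have "\<bar>orbit_sum f n x / real n - ?a\<bar> \<le> \<bar>K + \<bar>?a\<bar>\<bar>" using K(1) by linarith
      then show ?case unfolding real_norm_def abs_power2 by (simp only: abs_le_square_iff)
    qed
  qed auto
  then show ?thesis by simp
qed

end

subsection \<open>Uniform variance estimates\<close>

text \<open>Moving the summation range by i < m changes the sum by at most i, as the terms lie in
  [0,1]; averaging over i keeps the error below m. It serves both for visits along an orbit and for
  counting coordinates in windows.\<close>

lemma sliding_average_error:
  fixes g :: "nat \<Rightarrow> real"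
  assumes g: "\<And>j. 0 \<le> g j" "\<And>j. g j \<le> 1" and m: "m > 0"
  shows "\<bar>(\<Sum>j<n. g j) - (\<Sum>j<n. (\<Sum>i<m. g (j + i)) / real m)\<bar> \<le> real m"
proof -
  have shift: "\<bar>(\<Sum>j<n. g j) - (\<Sum>j<n. g (j + i))\<bar> \<le> real i" for i
  proof (induction i)
    case (Suc i)
    have "(\<Sum>j<n. g (j + Suc i)) - (\<Sum>j<n. g (j + i)) = g (n + i) - g (0 + i)"
      using sum_lessThan_telescope[of "\<lambda>j. g (j + i)" n] by (simp add: sum_subtractf)
    moreover have "\<bar>g (n + i) - g (0 + i)\<bar> \<le> 1"
      using g(1)[of "n + i"] g(2)[of "n + i"] g(1)[of "0 + i"] g(2)[of "0 + i"] by linarith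
    ultimately show ?case using Suc by simp
  qed simp
  have "(\<Sum>j<n. (\<Sum>i<m. g (j + i)) / real m) = (\<Sum>i<m. \<Sum>j<n. g (j + i)) / real m"
    unfolding sum_divide_distrib[symmetric] by (subst sum.swap) (rule refl)
  then have "(\<Sum>j<n. g j) - (\<Sum>j<n. (\<Sum>i<m. g (j + i)) / real m) =
      (\<Sum>i<m. (\<Sum>j<n. g j) - (\<Sum>j<n. g (j + i))) / real m"
    using m by (simp add: sum_subtractf diff_divide_distrib)
  also have "\<bar>\<dots>\<bar> \<le> (\<Sum>i<m. real m) / real m"
    unfolding abs_divide
  proof (rule frac_le)
    have "\<bar>\<Sum>i<m. (\<Sum>j<n. g j) - (\<Sum>j<n. g (j + i))\<bar> \<le>
        (\<Sum>i<m. \<bar>(\<Sum>j<n. g j) - (\<Sum>j<n. g (j + i))\<bar>)" by (rule sum_abs)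
    also have "\<dots> \<le> (\<Sum>i<m. real m)"
      by (intro sum_mono order.trans[OF shift]) simp
    finally show "\<bar>\<Sum>i<m. (\<Sum>j<n. g j) - (\<Sum>j<n. g (j + i))\<bar> \<le> (\<Sum>i<m. real m)" .
  qed (use m in auto)
  also have "\<dots> = real m" using m by simp
  finally show ?thesis .
qed

abbreviation visit :: "('i \<Rightarrow> 'a) set \<Rightarrow> ('i \<Rightarrow> 'a) \<Rightarrow> real" where
  "visit B \<equiv> (\<lambda>x. of_bool (x \<in> B))"

lemma orbit_sum_visit_smooth:
  assumes "n > 0"
  shows "\<bar>orbit_sum (visit B) l x - orbit_sum (\<lambda>z. orbit_sum (visit B) n z / real n) l x\<bar> \<le> real n"
proof -
  have "(shift ^^ i) ((shift ^^ j) x) = (shift ^^ (j + i)) x" for i j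
    by (metis add.commute comp_apply funpow_add)
  then have "orbit_sum (\<lambda>z. orbit_sum (visit B) n z / real n) l x =
      (\<Sum>j<l. (\<Sum>i<n. visit B ((shift ^^ (j + i)) x)) / real n)"
    by (simp only: orbit_sum_def)
  then show ?thesis
    using sliding_average_error[of "\<lambda>j. visit B ((shift ^^ j) x)" n l] assms
    unfolding orbit_sum_def[of "visit B" l x] by simp
qed

lemma cylinder_of_finite_family:
  assumes "finite \<C>" "\<And>C. C \<in> \<C> \<Longrightarrow> cylinder C"
    and "\<And>x y. (\<forall>C\<in>\<C>. x \<in> C \<longleftrightarrow> y \<in> C) \<Longrightarrow> x \<in> S \<Longrightarrow> y \<in> S"
  shows "cylinder S"
proof -
  have "\<forall>C\<in>\<C>. \<exists>F. finite F \<and> (\<forall>x y. (\<forall>i\<in>F. x i = y i) \<longrightarrow> (x \<in> C \<longleftrightarrow> y \<in> C))"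
    using assms(2) unfolding cylinder_def by blast
  then obtain F where F: "\<forall>C\<in>\<C>. finite (F C) \<and> (\<forall>x y. (\<forall>i\<in>F C. x i = y i) \<longrightarrow> (x \<in> C \<longleftrightarrow> y \<in> C))"
    by (rule bchoice[THEN exE])
  show ?thesis
  proof (rule cylinderI[of "\<Union>C\<in>\<C>. F C"])
    show "finite (\<Union>C\<in>\<C>. F C)" using F assms(1) by blast
    fix x y :: "'a \<Rightarrow> 'b"
    assume eq: "\<And>i. i \<in> (\<Union>C\<in>\<C>. F C) \<Longrightarrow> x i = y i" and "x \<in> S"
    have "x \<in> C \<longleftrightarrow> y \<in> C" if "C \<in> \<C>" for C
    proof -
      have "\<forall>i\<in>F C. x i = y i" using eq that by blast
      then show ?thesis using F that by blast
    qed
    then show "y \<in> S" using assms(3)[of x y] \<open>x \<in> S\<close> by blast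
  qed
qed

section \<open>Mean square deviation of orbit averages from a measure\<close>

context shift_space
begin

lemma continuous_on_visit: "cylinder B \<Longrightarrow> continuous_on X (visit B)"
  by (rule continuous_on_of_bool_cylinder)

lemma integral_visit:
  assumes "\<mu> \<in> prob_measures X" "cylinder B"
  shows "(\<integral>x. visit B x \<partial>\<mu>) = measure \<mu> (B \<inter> X)"
proof -
  have "(\<integral>x. visit B x \<partial>\<mu>) = (\<integral>x. indicator (B \<inter> X) x \<partial>\<mu>)"
    by (rule Bochner_Integration.integral_cong)
       (auto simp: prob_measuresD(2)[OF assms(1)] indicator_def)
  also have "\<dots> = measure \<mu> (B \<inter> X \<inter> space \<mu>)" by simp
  also have "B \<inter> X \<inter> space \<mu> = B \<inter> X" using prob_measuresD(2)[OF assms(1)] by blast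
  finally show ?thesis .
qed

text \<open>Integrated against an invariant \<open>\<mu>\<close> itself, this is the variance of the
  average over \<open>n\<close> shifts. Point and measure are separate arguments because one orbit
  will be compared with every ergodic measure.\<close>

definition deviation :: "('i \<Rightarrow> 'a) set \<Rightarrow> nat \<Rightarrow> ('i \<Rightarrow> 'a) measure \<Rightarrow> ('i \<Rightarrow> 'a) \<Rightarrow> real" where
  "deviation B n \<mu> x = (orbit_sum (visit B) n x / real n - measure \<mu> (B \<inter> X))\<^sup>2"

lemma continuous_on_deviation: "cylinder B \<Longrightarrow> continuous_on X (deviation B n \<mu>)"
  unfolding deviation_def divide_inverse
  by (intro continuous_on_power continuous_on_diff continuous_on_mult
        continuous_on_orbit_sum continuous_on_visit continuous_on_const)

lemma integral_orbit_sum: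
  assumes \<mu>: "\<mu> \<in> invariant_measures X" and f: "continuous_on X f"
  shows "(\<integral>x. orbit_sum f n x \<partial>\<mu>) = real n * (\<integral>x. f x \<partial>\<mu>)"
proof -
  have P: "\<mu> \<in> prob_measures X" using \<mu> by (simp add: invariant_measures_def)
  have "(\<integral>x. orbit_sum f n x \<partial>\<mu>) = (\<Sum>j<n. \<integral>x. f ((shift ^^ j) x) \<partial>\<mu>)"
    unfolding orbit_sum_def
    by (rule Bochner_Integration.integral_sum)
       (intro integrable_continuous[OF P] continuous_on_comp_shift f)
  also have "\<dots> = real n * (\<integral>x. f x \<partial>\<mu>)"
    by (simp add: integral_continuous_shift[OF \<mu> f])
  finally show ?thesis .
qed

text \<open>Up to an edge error of m/n, the n-average is the mean of the m-averages along the orbit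
  segment. The Cauchy-Schwarz inequality moves the square inside that mean, and the factors 2 come
  from splitting off the edge error.\<close>

lemma deviation_le:
  assumes "n > 0" "m > 0"
  shows "deviation B n \<mu> x \<le>
    2 * (orbit_sum (deviation B m \<mu>) n x / real n) + 2 * (real m / real n)\<^sup>2"
proof -
  let ?c = "measure \<mu> (B \<inter> X)"
  define s where "s = orbit_sum (visit B) n x"
  define u where "u j = orbit_sum (visit B) m ((shift ^^ j) x) / real m - ?c" for j
  define t where "t = (\<Sum>j<n. u j)"
  have t: "t = orbit_sum (\<lambda>z. orbit_sum (visit B) m z / real m) n x - real n * ?c"
    unfolding t_def u_def orbit_sum_def[of _ n] sum_subtractf by simp
  have "\<bar>s - real n * ?c - t\<bar> \<le> real m"
    using orbit_sum_visit_smooth[OF assms(2), of B n x] unfolding t s_def by simp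
  then have "(s - real n * ?c - t)\<^sup>2 \<le> (real m)\<^sup>2"
    by (simp add: abs_le_square_iff[symmetric])
  moreover have "t\<^sup>2 \<le> (\<Sum>j<n. (u j)\<^sup>2) * real n"
    using sum_squared_le_sum_of_squares[of u "{..<n}"] unfolding t_def by simp
  moreover have "(s - real n * ?c)\<^sup>2 \<le> 2 * t\<^sup>2 + 2 * (s - real n * ?c - t)\<^sup>2"
  proof -
    \<comment> \<open>With a the deviation of \<open>s\<close>:
      \<open>2 t^2 + 2 (a - t)^2 - a^2\<close> is the perfect square
      \<open>(2 t - a)^2\<close>.\<close>
    have "2 * t\<^sup>2 + 2 * (s - real n * ?c - t)\<^sup>2 - (s - real n * ?c)\<^sup>2 = (2 * t - (s - real n * ?c))\<^sup>2"
      by algebra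
    then show ?thesis using zero_le_power2[of "2 * t - (s - real n * ?c)"] by linarith
  qed
  ultimately have "(s - real n * ?c)\<^sup>2 \<le> 2 * ((\<Sum>j<n. (u j)\<^sup>2) * real n) + 2 * (real m)\<^sup>2"
    by linarith
  then have "(s - real n * ?c)\<^sup>2 / (real n)\<^sup>2 \<le> (2 * ((\<Sum>j<n. (u j)\<^sup>2) * real n) + 2 * (real m)\<^sup>2) / (real n)\<^sup>2"
    by (rule divide_right_mono) simp
  moreover have "(s - real n * ?c)\<^sup>2 / (real n)\<^sup>2 = deviation B n \<mu> x"
    using assms(1) unfolding deviation_def s_def power_divide[symmetric] by (simp add: diff_divide_distrib)
  moreover have "(2 * ((\<Sum>j<n. (u j)\<^sup>2) * real n) + 2 * (real m)\<^sup>2) / (real n)\<^sup>2 =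
      2 * ((\<Sum>j<n. (u j)\<^sup>2) / real n) + 2 * (real m / real n)\<^sup>2"
    using assms(1) by (simp add: field_simps power2_eq_square)
  moreover have "(\<Sum>j<n. (u j)\<^sup>2) = orbit_sum (deviation B m \<mu>) n x"
    unfolding orbit_sum_def[of _ n] deviation_def u_def ..
  ultimately show ?thesis by simp
qed

text \<open>The precise sense in which variances almost decrease: smallness at one \<open>m\<close>
  passes, up to a factor 2, to every \<open>n\<close> much larger than \<open>m\<close>, for every
  invariant measure.\<close>

lemma integral_deviation_le:
  assumes \<mu>: "\<mu> \<in> invariant_measures X" and B: "cylinder B" and nm: "n > 0" "m > 0"
  shows "(\<integral>x. deviation B n \<mu> x \<partial>\<mu>) \<le>
    2 * (\<integral>x. deviation B m \<mu> x \<partial>\<mu>) + 2 * (real m / real n)\<^sup>2"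
proof -
  have P: "\<mu> \<in> prob_measures X" using \<mu> by (simp add: invariant_measures_def)
  interpret prob_space \<mu> using P by (rule prob_measuresD)
  have int: "integrable \<mu> (orbit_sum (deviation B m \<mu>) n)"
    by (intro integrable_continuous[OF P] continuous_on_orbit_sum continuous_on_deviation B)
  have "(\<integral>x. deviation B n \<mu> x \<partial>\<mu>) \<le>
      (\<integral>x. 2 * (orbit_sum (deviation B m \<mu>) n x / real n) + 2 * (real m / real n)\<^sup>2 \<partial>\<mu>)"
    by (intro integral_mono deviation_le nm integrable_continuous[OF P] continuous_on_deviation B
          Bochner_Integration.integrable_add integrable_mult_right integrable_divide int integrable_const)
  also have "\<dots> = 2 * ((\<integral>x. orbit_sum (deviation B m \<mu>) n x \<partial>\<mu>) / real n) + 2 * (real m / real n)\<^sup>2"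
    by (subst Bochner_Integration.integral_add)
       (use int in \<open>simp_all add: prob_space\<close>)
  also have "(\<integral>x. orbit_sum (deviation B m \<mu>) n x \<partial>\<mu>) / real n = (\<integral>x. deviation B m \<mu> x \<partial>\<mu>)"
    using nm(1) by (simp add: integral_orbit_sum[OF \<mu> continuous_on_deviation[OF B]])
  finally show ?thesis .
qed

text \<open>Integrand and measure vary together. Expanding the square leaves integrals of two fixed
  continuous functions and the numbers \<open>measure \<nu> (B \<inter> X)\<close>, each of which
  converges.\<close>

lemma integral_deviation_tendsto:
  assumes ms: "\<And>k. ms k \<in> prob_measures X" and m: "\<mu> \<in> prob_measures X"
    and lim: "tends_to ms \<mu>" and B: "cylinder B"
  shows "(\<lambda>k. \<integral>x. deviation B n (ms k) x \<partial>ms k) \<longlonglongrightarrow> (\<integral>x. deviation B n \<mu> x \<partial>\<mu>)"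
proof -
  let ?A = "\<lambda>x. orbit_sum (visit B) n x / real n"
  have cA: "continuous_on X ?A"
    unfolding divide_inverse
    by (intro continuous_on_mult continuous_on_orbit_sum continuous_on_visit B continuous_on_const)
  have cA2: "continuous_on X (\<lambda>x. (?A x)\<^sup>2)" by (intro continuous_on_power cA)
  have eq: "(\<integral>x. deviation B n \<nu> x \<partial>\<nu>) =
      (\<integral>x. (?A x)\<^sup>2 \<partial>\<nu>) - 2 * measure \<nu> (B \<inter> X) * (\<integral>x. ?A x \<partial>\<nu>) + (measure \<nu> (B \<inter> X))\<^sup>2"
    if \<nu>: "\<nu> \<in> prob_measures X" for \<nu>
  proof -
    interpret prob_space \<nu> using \<nu> by (rule prob_measuresD)
    let ?c = "measure \<nu> (B \<inter> X)"
    have i1: "integrable \<nu> (\<lambda>x. (?A x)\<^sup>2)" and i2: "integrable \<nu> (\<lambda>x. 2 * ?c * ?A x)"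
      using integrable_continuous[OF \<nu> cA2] integrable_mult_right[OF integrable_continuous[OF \<nu> cA]] by auto
    have "(\<integral>x. deviation B n \<nu> x \<partial>\<nu>) = (\<integral>x. ((?A x)\<^sup>2 - 2 * ?c * ?A x) + ?c\<^sup>2 \<partial>\<nu>)"
      unfolding deviation_def by (intro Bochner_Integration.integral_cong refl) algebra
    also have "\<dots> = (\<integral>x. (?A x)\<^sup>2 - 2 * ?c * ?A x \<partial>\<nu>) + ?c\<^sup>2"
      by (subst Bochner_Integration.integral_add)
         (use Bochner_Integration.integrable_diff[OF i1 i2] in \<open>simp_all add: prob_space\<close>)
    also have "(\<integral>x. (?A x)\<^sup>2 - 2 * ?c * ?A x \<partial>\<nu>) = (\<integral>x. (?A x)\<^sup>2 \<partial>\<nu>) - (\<integral>x. 2 * ?c * ?A x \<partial>\<nu>)"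
      by (rule Bochner_Integration.integral_diff[OF i1 i2])
    also have "(\<integral>x. 2 * ?c * ?A x \<partial>\<nu>) = 2 * ?c * (\<integral>x. ?A x \<partial>\<nu>)"
      by (rule integral_mult_right_zero)
    finally show ?thesis .
  qed
  show ?thesis
    unfolding eq[OF ms] eq[OF m]
    by (intro tendsto_add tendsto_diff tendsto_mult tendsto_power tendsto_const tends_toD[OF lim B]
          tends_to_integral[OF cA ms m lim] tends_to_integral[OF cA2 ms m lim])
qed

lemma ergodic_in:
  "\<mu> \<in> ergodic_measures X \<Longrightarrow> \<mu> \<in> invariant_measures X"
  "\<mu> \<in> ergodic_measures X \<Longrightarrow> \<mu> \<in> prob_measures X"
  by (simp_all add: ergodic_measures_def invariant_measures_def)

text \<open>A Dini-type argument. A sequence of counterexamples has a limit that is ergodic by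
  closedness; the limit has small variance at some fixed \<open>m\<close>, so late members of the
  sequence do too, and near-monotonicity carries this to their own large \<open>n\<close>. The
  bounds \<open>\<delta> / 8\<close> and \<open>\<delta> / 4\<close> add up to
  \<open>\<delta> / 2\<close> after the doubling.\<close>

lemma uniform_deviation:
  assumes cl: "closedin (weak_star X) (ergodic_measures X)" and B: "cylinder B" and \<delta>: "\<delta> > 0"
  shows "\<exists>N. \<forall>n\<ge>N. \<forall>\<mu>\<in>ergodic_measures X. (\<integral>x. deviation B n \<mu> x \<partial>\<mu>) < \<delta>"
proof (rule ccontr)
  assume "\<not> ?thesis"
  then have "\<forall>k. \<exists>n \<mu>. n \<ge> Suc k \<and> \<mu> \<in> ergodic_measures X \<and> (\<integral>x. deviation B n \<mu> x \<partial>\<mu>) \<ge> \<delta>"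
    by (meson not_less)
  then obtain n ms where n: "\<And>k. n k \<ge> Suc k" and ms: "\<And>k. ms k \<in> ergodic_measures X"
    and big: "\<And>k. (\<integral>x. deviation B (n k) (ms k) x \<partial>ms k) \<ge> \<delta>"
    by metis
  have msP: "ms k \<in> prob_measures X" for k using ms by (rule ergodic_in)
  obtain r \<mu> where r: "strict_mono r" and \<mu>: "\<mu> \<in> prob_measures X" and lim: "tends_to (ms \<circ> r) \<mu>"
    using prob_measures_compact[of ms, OF msP] .
  have \<mu>E: "\<mu> \<in> ergodic_measures X"
    by (rule weak_star_closed_limit[OF cl _ _ \<mu> lim]) (use ms ergodic_in(2) in auto)
  have "(\<lambda>n. \<integral>x. deviation B n \<mu> x \<partial>\<mu>) \<longlonglongrightarrow> 0"
    using ergodic_variance[OF \<mu>E continuous_on_visit[OF B]]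
    unfolding integral_visit[OF \<mu> B] deviation_def .
  then have "\<forall>\<^sub>F n in sequentially. (\<integral>x. deviation B n \<mu> x \<partial>\<mu>) < \<delta> / 8"
    by (rule order_tendstoD) (use \<delta> in simp)
  then have "\<forall>\<^sub>F n in sequentially. (\<integral>x. deviation B n \<mu> x \<partial>\<mu>) < \<delta> / 8 \<and> n > 0"
    using eventually_gt_at_top by (rule eventually_conj)
  then obtain m where m: "(\<integral>x. deviation B m \<mu> x \<partial>\<mu>) < \<delta> / 8" "m > 0"
    unfolding eventually_sequentially by blast
  have "(\<lambda>k. \<integral>x. deviation B m ((ms \<circ> r) k) x \<partial>(ms \<circ> r) k) \<longlonglongrightarrow> (\<integral>x. deviation B m \<mu> x \<partial>\<mu>)"
    by (rule integral_deviation_tendsto[OF _ \<mu> lim B]) (simp add: msP)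
  then have ev1: "\<forall>\<^sub>F k in sequentially. (\<integral>x. deviation B m ((ms \<circ> r) k) x \<partial>(ms \<circ> r) k) < \<delta> / 8"
    by (rule order_tendstoD) (rule m)
  have "(\<lambda>k. 2 * (real m * inverse (real (Suc k)))\<^sup>2) \<longlonglongrightarrow> 2 * (real m * 0)\<^sup>2"
    by (intro tendsto_mult tendsto_power tendsto_const LIMSEQ_inverse_real_of_nat)
  then have ev2: "\<forall>\<^sub>F k in sequentially. 2 * (real m * inverse (real (Suc k)))\<^sup>2 < \<delta> / 4"
    by (rule order_tendstoD) (use \<delta> in simp)
  have "\<forall>\<^sub>F k in sequentially. False"
    using ev1 ev2
  proof eventually_elim
    case (elim k)
    have nk: "n (r k) \<ge> Suc k" using n[of "r k"] seq_suble[OF r, of k] by simp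
    have "real m / real (n (r k)) \<le> real m * inverse (real (Suc k))"
      using nk unfolding divide_inverse by (intro mult_left_mono le_imp_inverse_le) auto
    then have "(real m / real (n (r k)))\<^sup>2 \<le> (real m * inverse (real (Suc k)))\<^sup>2"
      by (rule power_mono) simp
    moreover have "\<delta> \<le> 2 * (\<integral>x. deviation B m (ms (r k)) x \<partial>ms (r k)) + 2 * (real m / real (n (r k)))\<^sup>2"
      using big[of "r k"] integral_deviation_le[OF ergodic_in(1)[OF ms] B _ m(2), of "n (r k)" "r k"] nk
      by linarith
    ultimately show False using elim \<delta> unfolding o_apply by linarith
  qed
  then show False by simp
qed

definition erratic :: "('i \<Rightarrow> 'a) set set \<Rightarrow> nat \<Rightarrow> nat \<Rightarrow> real \<Rightarrow> ('i \<Rightarrow> 'a) set" where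
  "erratic W n M \<delta> = {y. \<forall>\<nu>\<in>ergodic_measures X.
     \<delta> * real M \<le> orbit_sum (\<lambda>z. \<Sum>B\<in>W. deviation B n \<nu> z) M y}"

text \<open>The measures enter only as constants: the condition on a point depends on which
  cylinders of \<open>W\<close> its orbit visits before time \<open>M + n\<close>.\<close>

lemma cylinder_erratic:
  assumes W: "finite W" "\<And>B. B \<in> W \<Longrightarrow> cylinder B"
  shows "cylinder (erratic W n M \<delta>)"
proof (rule cylinder_of_finite_family)
  let ?C = "(\<lambda>(B, j). (shift ^^ j) -` B) ` (W \<times> {..<M + n})"
  show "finite ?C" using W by simp
  show "cylinder C" if "C \<in> ?C" for C
    using that W(2) cylinder_vimage_shift_funpow by auto
  fix x y assume eq: "\<forall>C\<in>?C. x \<in> C \<longleftrightarrow> y \<in> C" and x: "x \<in> erratic W n M \<delta>"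
  have "visit B ((shift ^^ j) x) = visit B ((shift ^^ j) y)" if "B \<in> W" "j < M + n" for B j
    using eq that by auto
  then have "orbit_sum (visit B) n ((shift ^^ j) x) = orbit_sum (visit B) n ((shift ^^ j) y)"
    if "B \<in> W" "j < M" for B j
    unfolding orbit_sum_def using that
    by (intro sum.cong refl) (simp add: funpow_add[symmetric, THEN fun_cong, unfolded o_apply] del: of_bool_eq_iff)
  then have "orbit_sum (\<lambda>z. \<Sum>B\<in>W. deviation B n \<nu> z) M x = orbit_sum (\<lambda>z. \<Sum>B\<in>W. deviation B n \<nu> z) M y" for \<nu>
    unfolding orbit_sum_def[of _ M] deviation_def by (intro sum.cong refl) simp
  then show "y \<in> erratic W n M \<delta>" using x by (simp add: erratic_def)
qed

text \<open>If orbits visited the set too often, an invariant and then an ergodic measure would give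
  it mass at least \<open>e\<close>. For this measure \<nu> the defining inequality may be used with
  \<nu> itself, and Markov's inequality contradicts the small variances. The length \<open>n\<close>
  is chosen before \<open>M\<close>, as both sides of the estimate scale with
  \<open>M\<close>.\<close>

lemma erratic_rare:
  assumes cl: "closedin (weak_star X) (ergodic_measures X)"
    and W: "finite W" "\<And>B. B \<in> W \<Longrightarrow> cylinder B" and \<delta>: "\<delta> > 0" and e: "e > 0"
  shows "\<exists>n>0. \<forall>M>0. \<exists>N0. \<forall>N\<ge>N0. \<forall>y\<in>X. orbit_sum (visit (erratic W n M \<delta>)) N y \<le> e * real N"
proof -
  \<comment> \<open>The summand 1 makes \<open>card W * d\<close> strictly smaller than
    \<open>e * \<delta>\<close>, also when \<open>W\<close> is empty.\<close>
  define d where "d = e * \<delta> / (real (card W) + 1)"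
  have d: "d > 0" unfolding d_def using \<delta> e by simp
  have "\<forall>B\<in>W. \<exists>N. \<forall>n\<ge>N. \<forall>\<mu>\<in>ergodic_measures X. (\<integral>x. deviation B n \<mu> x \<partial>\<mu>) < d"
    using uniform_deviation[OF cl W(2) d] by blast
  then obtain Nf where Nf: "\<forall>B\<in>W. \<forall>n\<ge>Nf B. \<forall>\<mu>\<in>ergodic_measures X. (\<integral>x. deviation B n \<mu> x \<partial>\<mu>) < d"
    by (rule bchoice[THEN exE])
  define n where "n = Suc (\<Sum>B\<in>W. Nf B)"
  have "Nf B \<le> n" if "B \<in> W" for B
    using member_le_sum[OF that, of Nf] W(1) unfolding n_def by simp
  then have small: "(\<integral>x. deviation B n \<mu> x \<partial>\<mu>) < d" if "B \<in> W" "\<mu> \<in> ergodic_measures X" for B \<mu>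
    using Nf that by blast
  have "\<exists>N0. \<forall>N\<ge>N0. \<forall>y\<in>X. orbit_sum (visit (erratic W n M \<delta>)) N y \<le> e * real N" if M: "M > 0" for M
  proof (rule ccontr)
    let ?B = "erratic W n M \<delta>"
    have cyl: "cylinder ?B" by (rule cylinder_erratic[OF W])
    assume "\<not> (\<exists>N0. \<forall>N\<ge>N0. \<forall>y\<in>X. orbit_sum (visit ?B) N y \<le> e * real N)"
    then have "\<forall>k. \<exists>N y. N \<ge> Suc k \<and> y \<in> X \<and> orbit_sum (visit ?B) N y \<ge> e * real N"
      by (meson not_le less_imp_le)
    then obtain N y where Ny: "\<And>k. N k \<ge> Suc k" "\<And>k. y k \<in> X"
      "\<And>k. orbit_sum (visit ?B) (N k) (y k) \<ge> e * real (N k)"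
      by metis
    have "\<exists>m\<in>invariant_measures X. measure m (?B \<inter> X) \<ge> e"
      by (rule invariant_of_long_orbits[OF Ny(2,1) cyl]) (use Ny(3) in \<open>simp add: orbit_sum_def\<close>)
    then obtain \<nu> where \<nu>: "\<nu> \<in> ergodic_measures X" and ge: "measure \<nu> (?B \<inter> X) \<ge> e"
      using ergodic_maximizer[OF _ cyl] by (meson order_trans)
    have I: "\<nu> \<in> invariant_measures X" and P: "\<nu> \<in> prob_measures X" using \<nu> by (rule ergodic_in)+
    interpret prob_space \<nu> using P by (rule prob_measuresD)
    let ?h = "\<lambda>z. \<Sum>B\<in>W. deviation B n \<nu> z"
    have ch: "continuous_on X ?h" by (intro continuous_on_sum continuous_on_deviation W)
    have h0: "0 \<le> orbit_sum ?h M x" for x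
      unfolding orbit_sum_def deviation_def by (intro sum_nonneg) simp
    have "e * (\<delta> * real M) \<le> measure \<nu> (?B \<inter> X) * (\<delta> * real M)"
      using ge \<delta> by (intro mult_right_mono) auto
    also have "\<dots> = (\<integral>x. visit ?B x \<partial>\<nu>) * (\<delta> * real M)"
      by (simp only: integral_visit[OF P cyl])
    also have "\<dots> = (\<integral>x. visit ?B x * (\<delta> * real M) \<partial>\<nu>)"
      by (rule integral_mult_left_zero[symmetric])
    also have "\<dots> \<le> (\<integral>x. orbit_sum ?h M x \<partial>\<nu>)"
    proof (rule integral_mono)
      show "integrable \<nu> (\<lambda>x. visit ?B x * (\<delta> * real M))"
        by (intro integrable_mult_left integrable_continuous[OF P] continuous_on_visit cyl)
      show "integrable \<nu> (orbit_sum ?h M)"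
        by (intro integrable_continuous[OF P] continuous_on_orbit_sum ch)
      show "visit ?B x * (\<delta> * real M) \<le> orbit_sum ?h M x" for x
        using h0[of x] \<nu> by (cases "x \<in> ?B") (auto simp: erratic_def)
    qed
    also have "\<dots> = real M * (\<integral>x. ?h x \<partial>\<nu>)" by (rule integral_orbit_sum[OF I ch])
    also have "(\<integral>x. ?h x \<partial>\<nu>) = (\<Sum>B\<in>W. \<integral>x. deviation B n \<nu> x \<partial>\<nu>)"
      by (intro Bochner_Integration.integral_sum integrable_continuous[OF P] continuous_on_deviation W)
    also have "real M * \<dots> \<le> real M * (\<Sum>B\<in>W. d)"
      by (intro mult_left_mono sum_mono less_imp_le[OF small] \<nu>) auto
    also have "\<dots> = real M * (real (card W) * d)" by simp
    also have "\<dots> < real M * ((real (card W) + 1) * d)" using M d by simp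
    also have "\<dots> = e * (\<delta> * real M)" unfolding d_def by (simp add: field_simps)
    finally show False by simp
  qed
  moreover have "n > 0" by (simp add: n_def)
  ultimately show ?thesis by blast
qed

end

subsection \<open>Frequencies of words in blocks\<close>

definition word_cylinder :: "'a list \<Rightarrow> ('i::linordered_semidom \<Rightarrow> 'a) set" where
  "word_cylinder C = {x. subblock x 0 (length C) = C}"

lemma length_subblock [simp]: "length (subblock x i k) = k"
  by (simp add: subblock_def)

lemma subblock_shift: "subblock x (i + of_nat j) k = subblock ((shift ^^ j) x) i k"
  by (simp add: subblock_def shift_funpow_apply add_ac)

lemma take_drop_subblock:
  "i + c \<le> k \<Longrightarrow> take c (drop i (subblock x p k)) = subblock x (p + of_nat i) c"
  by (rule nth_equalityI) (auto simp: subblock_def add_ac)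

lemma cylinder_word_cylinder:
  "cylinder (word_cylinder C :: ('i::linordered_semidom \<Rightarrow> 'a) set)"
proof (rule cylinderI[of "of_nat ` {..<length C}"])
  fix x y :: "'i \<Rightarrow> 'a"
  assume eq: "\<And>i. i \<in> of_nat ` {..<length C} \<Longrightarrow> x i = y i" and x: "x \<in> word_cylinder C"
  have "subblock x 0 (length C) = subblock y 0 (length C)"
    unfolding subblock_def using eq by (intro map_cong refl) auto
  then show "y \<in> word_cylinder C" using x by (simp add: word_cylinder_def)
qed simp

text \<open>\<open>Fr\<close> counts the occurrences contained in the block, the orbit sum those
  that start in it. They can differ only at the last \<open>length C - 1\<close> starting
  positions.\<close>

lemma Fr_subblock:
  assumes C: "1 \<le> length C" and l: "length C \<le> l"
  shows "\<bar>Fr (subblock x p l) C * real l - orbit_sum (visit (word_cylinder C)) l (\<lambda>j. x (j + p))\<bar>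
    \<le> real (length C)"
proof -
  let ?c = "length C" and ?y = "\<lambda>j. x (j + p)"
  let ?g = "\<lambda>i. visit (word_cylinder C) ((shift ^^ i) ?y)"
  have sub: "subblock ((shift ^^ i) ?y) 0 ?c = subblock x (p + of_nat i) ?c" for i
    unfolding subblock_shift[symmetric] by (simp add: subblock_def add_ac)
  have "{i. i \<le> l - ?c \<and> take ?c (drop i (subblock x p l)) = C} =
      {..<Suc (l - ?c)} \<inter> {i. (shift ^^ i) ?y \<in> word_cylinder C}"
  proof (intro set_eqI)
    fix i
    show "i \<in> {i. i \<le> l - ?c \<and> take ?c (drop i (subblock x p l)) = C} \<longleftrightarrow>
        i \<in> {..<Suc (l - ?c)} \<inter> {i. (shift ^^ i) ?y \<in> word_cylinder C}"
    proof (cases "i \<le> l - ?c")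
      case True
      then have "i + ?c \<le> l" using l by linarith
      with True show ?thesis by (simp add: take_drop_subblock word_cylinder_def sub)
    qed simp
  qed
  then have "Fr (subblock x p l) C * real l = (\<Sum>i<Suc (l - ?c). ?g i)"
    using assms by (simp add: Fr_def of_bool_def sum.If_cases del: sum.lessThan_Suc lessThan_Suc)
  moreover have "orbit_sum (visit (word_cylinder C)) l ?y =
      (\<Sum>i<Suc (l - ?c). ?g i) + (\<Sum>i=Suc (l - ?c)..<l. ?g i)"
    unfolding orbit_sum_def lessThan_atLeast0
    by (rule sum.atLeastLessThan_concat[symmetric]) (use assms in auto)
  moreover have "0 \<le> (\<Sum>i=Suc (l - ?c)..<l. ?g i)" by (intro sum_nonneg) simp
  moreover have "(\<Sum>i=Suc (l - ?c)..<l. ?g i) \<le> (\<Sum>i=Suc (l - ?c)..<l. 1)"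
    by (intro sum_mono) simp
  moreover have "(\<Sum>i=Suc (l - ?c)..<l. 1 :: real) \<le> real ?c" using l by simp
  ultimately show ?thesis by linarith
qed

text \<open>Over the whole block the frequency error amounts to at least \<open>\<eta> * l\<close>.
  Half of it absorbs the two edge errors, \<open>L\<close> for occurrences leaving the block and
  \<open>n\<close> for smoothing by \<open>n\<close>-averages; the Cauchy-Schwarz inequality turns
  the other half into a bound on the sum of squares.\<close>

lemma block_deviation:
  assumes C: "1 \<le> length C" "length C \<le> L" and l: "L \<le> l" "real L + real n \<le> \<eta> / 2 * real l"
    and n: "n > 0" and off: "\<eta> \<le> \<bar>Fr (subblock x p l) C - c\<bar>" and \<eta>: "\<eta> > 0"
  shows "real l * (\<eta> / 2)\<^sup>2 \<le>
    orbit_sum (\<lambda>z. (orbit_sum (visit (word_cylinder C)) n z / real n - c)\<^sup>2) l (\<lambda>j. x (j + p))"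
proof -
  let ?y = "\<lambda>j. x (j + p)" and ?f = "visit (word_cylinder C)"
  have lpos: "real l > 0" using C l by simp
  define u where "u j = orbit_sum ?f n ((shift ^^ j) ?y) / real n - c" for j
  have sum_u: "(\<Sum>j<l. u j) = orbit_sum (\<lambda>z. orbit_sum ?f n z / real n) l ?y - real l * c"
    unfolding u_def orbit_sum_def[of _ l] sum_subtractf by simp
  have "\<bar>Fr (subblock x p l) C * real l - orbit_sum ?f l ?y\<bar> \<le> real L"
    using Fr_subblock[of C l x p] C l by linarith
  moreover have "\<bar>orbit_sum ?f l ?y - orbit_sum (\<lambda>z. orbit_sum ?f n z / real n) l ?y\<bar> \<le> real n"
    by (rule orbit_sum_visit_smooth[OF n])
  moreover have "\<eta> * real l \<le> \<bar>Fr (subblock x p l) C * real l - real l * c\<bar>"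
  proof -
    have "\<eta> * real l \<le> \<bar>Fr (subblock x p l) C - c\<bar> * real l"
      using off lpos by (intro mult_right_mono) auto
    also have "\<dots> = \<bar>(Fr (subblock x p l) C - c) * real l\<bar>" by (simp add: abs_mult)
    also have "(Fr (subblock x p l) C - c) * real l = Fr (subblock x p l) C * real l - real l * c"
      by (simp add: algebra_simps)
    finally show ?thesis .
  qed
  ultimately have "\<bar>\<Sum>j<l. u j\<bar> \<ge> \<eta> / 2 * real l"
    unfolding sum_u using l(2) by linarith
  then have "(\<eta> / 2 * real l)\<^sup>2 \<le> (\<Sum>j<l. u j)\<^sup>2"
    using \<eta> lpos by (simp add: abs_le_square_iff[symmetric])
  also have "\<dots> \<le> (\<Sum>j<l. (u j)\<^sup>2) * real l"
    using sum_squared_le_sum_of_squares[of u "{..<l}"] by simp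
  finally have "(real l * (\<eta> / 2)\<^sup>2) * real l \<le> (\<Sum>j<l. (u j)\<^sup>2) * real l"
    by (simp add: power2_eq_square algebra_simps)
  then have "real l * (\<eta> / 2)\<^sup>2 \<le> (\<Sum>j<l. (u j)\<^sup>2)"
    using lpos by (rule mult_right_le_imp_le)
  then show ?thesis unfolding u_def orbit_sum_def[of _ l] .
qed

lemma finite_words: "finite {C :: 'a::finite list. length C = l}"
  using finite_lists_length_eq[of "UNIV :: 'a set" l] by simp

text \<open>Each starting position carries one word of length \<open>l\<close>, and as
  \<open>l\<close> is at least 1 there are at most \<open>length B\<close> positions. This bound,
  and its analogue for measures, dominates the series \<open>dstar\<close>.\<close>

lemma sum_Fr_le_1:
  fixes B :: "'a::finite list"
  assumes "l \<ge> 1"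
  shows "(\<Sum>C\<in>{C. length C = l}. Fr B C) \<le> 1"
proof (cases "l \<le> length B")
  case True
  let ?I = "{..length B - l}"
  let ?W = "{C :: 'a list. length C = l}"
  have "(\<Sum>C\<in>?W. Fr B C) = (\<Sum>C\<in>?W. real (card {i \<in> ?I. take l (drop i B) = C}) / real (length B))"
    using True by (intro sum.cong refl) (auto simp: Fr_def intro!: arg_cong[where f = card])
  also have "\<dots> = (\<Sum>C\<in>?W. \<Sum>i\<in>{i \<in> ?I. take l (drop i B) = C}. 1) / real (length B)"
    by (simp add: sum_divide_distrib)
  also have "(\<Sum>C\<in>?W. \<Sum>i\<in>{i \<in> ?I. take l (drop i B) = C}. 1 :: real) = (\<Sum>i\<in>?I. 1)"
    by (rule sum.group) (use True finite_words in auto)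
  also have "(\<Sum>i\<in>?I. 1 :: real) / real (length B) \<le> 1"
  proof -
    have "length B > 0" using True assms by linarith
    then show ?thesis using True assms by (subst divide_le_eq_1_pos) (simp_all add: of_nat_diff)
  qed
  finally show ?thesis .
next
  case False
  then have "(\<Sum>C\<in>{C. length C = l}. Fr B C) = (\<Sum>C\<in>{C :: 'a list. length C = l}. 0)"
    by (intro sum.cong refl) (auto simp: Fr_def)
  then show ?thesis by simp
qed

lemma Fr_nonneg: "0 \<le> Fr B C"
  by (simp add: Fr_def)

section \<open>From neighbourhoods in \<open>dstar\<close> to finitely many word frequencies\<close>

context shift_space
begin

lemma val_Inr: "\<mu> \<in> prob_measures X \<Longrightarrow> val (Inr \<mu>) C = measure \<mu> (word_cylinder C \<inter> X)"
  by (auto simp: prob_measuresD(2) word_cylinder_def intro!: arg_cong[where f = "measure \<mu>"])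

lemma sum_word_measure_le_1:
  assumes "\<mu> \<in> prob_measures X"
  shows "(\<Sum>C\<in>{C. length C = l}. measure \<mu> (word_cylinder C \<inter> X)) \<le> 1"
proof -
  interpret prob_space \<mu> using assms by (rule prob_measuresD)
  have "(\<Sum>C\<in>{C. length C = l}. measure \<mu> (word_cylinder C \<inter> X)) =
      measure \<mu> (\<Union>C\<in>{C. length C = l}. word_cylinder C \<inter> X)"
    by (rule finite_measure_finite_Union[symmetric])
       (auto simp: finite_words disjoint_family_on_def word_cylinder_def
          intro!: cylinder_in_sets[OF assms] cylinder_word_cylinder[unfolded word_cylinder_def])
  then show ?thesis by (simp add: prob_le_1)
qed

text \<open>Openness gives a radius for each ergodic measure separately; compactness of the set of
  ergodic measures makes it uniform. Otherwise there are blocks outside \<open>U\<close> whose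
  frequencies approach those of ergodic measures; a limit of these measures is ergodic, and the
  blocks tend to it in \<open>dstar\<close>.\<close>

lemma open_neighbourhood_blocks:
  assumes cl: "closedin (weak_star X) (ergodic_measures X)"
    and op: "dstar_open X U" and sub: "Inr ` ergodic_measures X \<subseteq> U"
  shows "\<exists>L. \<exists>\<eta>>0. \<forall>B\<in>blocks X. \<forall>\<nu>\<in>ergodic_measures X.
    (\<forall>C. 1 \<le> length C \<and> length C \<le> L \<longrightarrow> \<bar>Fr B C - measure \<nu> (word_cylinder C \<inter> X)\<bar> < \<eta>) \<longrightarrow> Inl B \<in> U"
proof (rule ccontr)
  assume neg: "\<not> ?thesis"
  have "\<exists>B \<nu>. B \<in> blocks X \<and> \<nu> \<in> ergodic_measures X \<and> Inl B \<notin> U \<and>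
      (\<forall>C. 1 \<le> length C \<and> length C \<le> k \<longrightarrow>
        \<bar>Fr B C - measure \<nu> (word_cylinder C \<inter> X)\<bar> < inverse (real (Suc k)))" for k
  proof -
    have "inverse (real (Suc k)) > 0" by simp
    with neg show ?thesis by blast
  qed
  then obtain B ms where B: "\<And>k. B k \<in> blocks X" "\<And>k. Inl (B k) \<notin> U"
    and ms: "\<And>k. ms k \<in> ergodic_measures X"
    and near: "\<And>k C. 1 \<le> length C \<and> length C \<le> k \<Longrightarrow>
        \<bar>Fr (B k) C - measure (ms k) (word_cylinder C \<inter> X)\<bar> < inverse (real (Suc k))"
    by metis
  have msP: "ms k \<in> prob_measures X" for k using ms by (rule ergodic_in)
  obtain r \<mu> where r: "strict_mono r" and \<mu>: "\<mu> \<in> prob_measures X" and lim: "tends_to (ms \<circ> r) \<mu>"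
    using prob_measures_compact[of ms, OF msP] .
  have \<mu>E: "\<mu> \<in> ergodic_measures X"
    by (rule weak_star_closed_limit[OF cl _ _ \<mu> lim]) (use ms ergodic_in(2) in auto)
  let ?t = "\<lambda>l k. (1 / 2) ^ Suc l *
      (\<Sum>C\<in>{C. length C = Suc l}. \<bar>measure \<mu> (word_cylinder C \<inter> X) - Fr (B (r k)) C\<bar>)"
  have term_lim: "(\<lambda>k. \<bar>measure \<mu> (word_cylinder C \<inter> X) - Fr (B (r k)) C\<bar>) \<longlonglongrightarrow> 0"
    if C: "1 \<le> length C" for C
  proof -
    have "(\<lambda>k. Fr (B (r k)) C - measure (ms (r k)) (word_cylinder C \<inter> X)) \<longlonglongrightarrow> 0"
    proof (rule Lim_null_comparison[OF _ LIMSEQ_inverse_real_of_nat])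
      show "\<forall>\<^sub>F k in sequentially. norm (Fr (B (r k)) C - measure (ms (r k)) (word_cylinder C \<inter> X))
          \<le> inverse (real (Suc k))"
      proof (rule eventually_sequentiallyI)
        fix k assume k: "length C \<le> k"
        have rk: "k \<le> r k" by (rule seq_suble[OF r])
        have "\<bar>Fr (B (r k)) C - measure (ms (r k)) (word_cylinder C \<inter> X)\<bar> < inverse (real (Suc (r k)))"
          by (rule near) (use C k rk in simp)
        also have "\<dots> \<le> inverse (real (Suc k))" using rk by (simp add: le_imp_inverse_le)
        finally show "norm (Fr (B (r k)) C - measure (ms (r k)) (word_cylinder C \<inter> X)) \<le> inverse (real (Suc k))"
          by simp
      qed
    qed
    from tendsto_add[OF this tends_toD[OF lim cylinder_word_cylinder[of C]]]
    have "(\<lambda>k. Fr (B (r k)) C) \<longlonglongrightarrow> measure \<mu> (word_cylinder C \<inter> X)" by (simp add: o_def)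
    from tendsto_rabs[OF tendsto_diff[OF tendsto_const[of "measure \<mu> (word_cylinder C \<inter> X)"] this]]
    show ?thesis by simp
  qed
  \<comment> \<open>Each summand tends to 0, and the words of one length contribute at most 2 before
    weighting, so limit and series may be exchanged.\<close>
  have "(\<lambda>k. \<Sum>l. ?t l k) \<longlonglongrightarrow> (\<Sum>l. 0)"
  proof (rule tannerys_theorem[THEN conjunct2, THEN conjunct2])
    show "(\<lambda>k. ?t l k) \<longlonglongrightarrow> 0" for l
    proof -
      have "(\<lambda>k. ?t l k) \<longlonglongrightarrow> (1 / 2) ^ Suc l * (\<Sum>C\<in>{C :: 'a list. length C = Suc l}. 0)"
        by (intro tendsto_mult tendsto_const tendsto_sum term_lim) simp
      then show ?thesis by simp
    qed
    have "norm (?t l k) \<le> (1 / 2) ^ l" for l k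
    proof -
      have "(\<Sum>C\<in>{C. length C = Suc l}. \<bar>measure \<mu> (word_cylinder C \<inter> X) - Fr (B (r k)) C\<bar>) \<le>
          (\<Sum>C\<in>{C. length C = Suc l}. measure \<mu> (word_cylinder C \<inter> X) + Fr (B (r k)) C)"
        by (intro sum_mono) (simp add: abs_le_iff Fr_nonneg add_increasing add_increasing2)
      also have "\<dots> \<le> 2"
        unfolding sum.distrib
        using sum_word_measure_le_1[OF \<mu>, of "Suc l"] sum_Fr_le_1[of "Suc l" "B (r k)"] by simp
      finally have "?t l k \<le> (1 / 2) ^ Suc l * 2" by (intro mult_left_mono) auto
      moreover have "?t l k \<ge> 0" by (intro mult_nonneg_nonneg sum_nonneg) auto
      ultimately show ?thesis by simp
    qed
    then show "\<forall>\<^sub>F (l, k) in sequentially \<times>\<^sub>F sequentially. norm (?t l k) \<le> (1 / 2) ^ l"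
      by (intro always_eventually) auto
  qed (auto intro!: summable_geometric)
  then have "(\<lambda>k. dstar (Inr \<mu>) (Inl (B (r k)))) \<longlonglongrightarrow> 0"
    unfolding dstar_def val_Inr[OF \<mu>] by simp
  moreover have "Inr \<mu> \<in> U" using sub \<mu>E by blast
  then obtain e where e: "e > 0" "\<And>q. q \<in> blocks_measures X \<Longrightarrow> dstar (Inr \<mu>) q < e \<Longrightarrow> q \<in> U"
    using op unfolding dstar_open_def by blast
  ultimately have "\<forall>\<^sub>F k in sequentially. dstar (Inr \<mu>) (Inl (B (r k))) < e"
    using order_tendstoD(2) by blast
  then obtain k where "dstar (Inr \<mu>) (Inl (B (r k))) < e"
    unfolding eventually_sequentially by blast
  moreover have "Inl (B (r k)) \<in> blocks_measures X" using B(1) by (simp add: blocks_measures_def)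
  ultimately show False using e(2) B(2) by blast
qed

end

subsection \<open>Density of nonergodic blocks\<close>

text \<open>The interface shared by both cases. Over \<open>int\<close>, \<open>translate\<close>
  also covers negative \<open>i\<close> and so contains the surjectivity of the shift on
  \<open>X\<close>; \<open>interval_eq\<close> expresses the discreteness of the
  coordinates.\<close>

locale subshift = shift_space X
  for X :: "('i::{linordered_semidom,countable} \<Rightarrow> 'a::{finite,discrete_topology}) set" +
  assumes translate: "x \<in> X \<Longrightarrow> (\<lambda>j. x (j + i)) \<in> X"
    and interval_eq: "{i..<i + of_nat n} = (\<lambda>j. (i::'i) + of_nat j) ` {..<n}"
begin

lemma inj_on_translate: "inj_on (\<lambda>j. (i::'i) + of_nat j) S"
  by (auto simp: inj_on_def)

lemma card_Int_interval:
  "real (card (A \<inter> {i..<i + of_nat N})) = (\<Sum>t<N. of_bool ((i::'i) + of_nat t \<in> A))"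
proof -
  have "A \<inter> {i..<i + of_nat N} = (\<lambda>j. i + of_nat j) ` ({..<N} \<inter> {t. i + of_nat t \<in> A})"
    unfolding interval_eq by auto
  then have "card (A \<inter> {i..<i + of_nat N}) = card ({..<N} \<inter> {t. i + of_nat t \<in> A})"
    by (simp add: card_image[OF inj_on_translate])
  then show ?thesis by (simp add: of_bool_def sum.If_cases)
qed

lemma upper_banach_density_le:
  fixes A :: "'i set"
  assumes N: "N \<ge> 1" and le: "\<And>i. real (card (A \<inter> {i..<i + of_nat N})) \<le> c * real N"
  shows "upper_banach_density A \<le> c"
proof -
  let ?f = "\<lambda>N i. real (card (A \<inter> {i..<i + of_nat N})) / real N"
  have f_le: "?f N i \<le> 1" for N i
  proof -
    have "(\<Sum>t<N. of_bool (i + of_nat t \<in> A) :: real) \<le> (\<Sum>t<N. 1)"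
      by (rule sum_mono) simp
    then show ?thesis unfolding card_Int_interval by (cases "N = 0") simp_all
  qed
  have "0 \<le> (SUP i. ?f N i)" for N
  proof -
    have "?f N 0 \<le> (SUP i. ?f N i)"
      by (rule cSUP_upper) (auto intro!: bdd_aboveI2[of _ _ 1] f_le)
    then show ?thesis by (rule order.trans[rotated]) simp
  qed
  then have "bdd_below ((\<lambda>N. SUP i. ?f N i) ` {1..})" by (intro bdd_belowI2[of _ 0])
  then have "upper_banach_density A \<le> (SUP i. ?f N i)"
    unfolding upper_banach_density_def by (rule cINF_lower) (use N in simp)
  also have "\<dots> \<le> c"
    by (rule cSUP_least) (use le N in \<open>simp_all add: divide_le_eq\<close>)
  finally show ?thesis .
qed

text \<open>\<open>partition_on\<close> speaks of the intervals as sets, not of the pairs that name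
  them. A nonempty interval determines its start as least element and its length as
  cardinality.\<close>

lemma decomposition_unique:
  fixes D :: "('i \<times> nat) set"
  assumes D: "decomposition D" and pl: "(p, l) \<in> D" "(p', l') \<in> D"
    and t: "t \<in> {p..<p + of_nat l}" "t \<in> {p'..<p' + of_nat l'}"
  shows "p = p' \<and> l = l'"
proof -
  have "{p..<p + of_nat l} = {p'..<p' + of_nat l'}"
  proof (rule ccontr)
    assume ne: "{p..<p + of_nat l} \<noteq> {p'..<p' + of_nat l'}"
    have "disjoint ((\<lambda>(i, n). {i..<i + of_nat n}) ` D)"
      using D unfolding decomposition_def by (rule partition_onD2)
    then have "{p..<p + of_nat l} \<inter> {p'..<p' + of_nat l'} = {}"
      by (rule disjointD) (use pl ne in force)+
    then show False using t by blast
  qed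
  note eq = this
  have "p < p + of_nat l" "p' < p' + of_nat l'"
    using t by (meson atLeastLessThan_iff le_less_trans)+
  then have "p \<in> {p..<p + of_nat l}" "p' \<in> {p'..<p' + of_nat l'}"
    by (simp_all only: atLeastLessThan_iff order.refl simp_thms)
  then have "p = p'" using eq by (metis atLeastLessThan_iff order_antisym)
  moreover have "card ((\<lambda>j. p + of_nat j) ` {..<l}) = card ((\<lambda>j. p' + of_nat j) ` {..<l'})"
    using eq unfolding interval_eq by simp
  then have "l = l'" by (simp add: card_image[OF inj_on_translate])
  ultimately show ?thesis by simp
qed

text \<open>Bad blocks inside the window are disjoint, and each pays \<open>\<kappa>\<close> per
  coordinate out of the orbit sum of the nonnegative \<open>h\<close>. Bad blocks crossing an end of
  the window reach at most \<open>K\<close> coordinates into it, hence the term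
  \<open>2 * real K\<close>.\<close>

lemma window_count:
  fixes D :: "('i \<times> nat) set"
  assumes D: "decomposition D" and bad: "bad \<subseteq> D" and K: "\<And>p l. (p, l) \<in> bad \<Longrightarrow> l \<le> K"
    and h: "\<And>z. 0 \<le> h z" and \<kappa>: "\<kappa> \<ge> 0"
    and blk: "\<And>p l. (p, l) \<in> bad \<Longrightarrow> real l * \<kappa> \<le> orbit_sum h l (\<lambda>j. x (j + p))"
  shows "\<kappa> * (\<Sum>t<M. of_bool (i + of_nat t \<in> (\<Union>(p, l)\<in>bad. {p..<p + of_nat l}))) \<le>
    \<kappa> * (2 * real K) + orbit_sum h M (\<lambda>j. x (j + i))"
proof -
  let ?A = "\<Union>(p, l)\<in>bad. {p..<p + of_nat l}"
  let ?y = "\<lambda>j. x (j + i)"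
  \<comment> \<open>The bad blocks contained in the window, recorded by their offset from its start
    \<open>i\<close>.\<close>
  define P where "P = {(q, l). (i + of_nat q, l) \<in> bad \<and> q + l \<le> M}"
  let ?I = "\<lambda>(q, l). {q..<q + l :: nat}"
  have "P \<subseteq> {..M} \<times> {..M}" by (auto simp: P_def)
  then have fin: "finite P" by (rule finite_subset) simp
  have disj: "?I a \<inter> ?I b = {}" if ab: "a \<in> P" "b \<in> P" "a \<noteq> b" for a b
  proof (rule ccontr)
    assume ne: "?I a \<inter> ?I b \<noteq> {}"
    obtain q l q' l' where eq: "a = (q, l)" "b = (q', l')" by (meson surj_pair)
    from ne have "{q..<q + l} \<inter> {q'..<q' + l'} \<noteq> {}" by (simp only: eq prod.case not_False_eq_True)
    then obtain t where t: "t \<in> {q..<q + l}" "t \<in> {q'..<q' + l'}" by blast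
    have in_interval: "i + of_nat t \<in> {i + of_nat q..<i + of_nat q + of_nat l}"
      if "t \<in> {q..<q + l}" for q l
    proof -
      have "i + of_nat t = (i + of_nat q) + of_nat (t - q)"
        using that by (simp add: of_nat_add[symmetric] add.assoc del: of_nat_add)
      then show ?thesis unfolding interval_eq using that by (intro image_eqI[of _ _ "t - q"]) auto
    qed
    have "i + of_nat q = i + of_nat q' \<and> l = l'"
      by (rule decomposition_unique[OF D _ _ in_interval[OF t(1)] in_interval[OF t(2)]])
         (use ab bad eq in \<open>auto simp: P_def\<close>)
    then show False using ab eq by simp
  qed
  have block_sum: "orbit_sum h l (\<lambda>j. x (j + (i + of_nat q))) = (\<Sum>t\<in>{q..<q + l}. h ((shift ^^ t) ?y))" for q l
  proof -
    have "(shift ^^ s) (\<lambda>j. x (j + (i + of_nat q))) = (shift ^^ (q + s)) ?y" for s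
      by (rule ext) (simp add: shift_funpow_apply add_ac)
    then show ?thesis
      unfolding orbit_sum_def by (simp add: sum.atLeastLessThan_shift_0[of _ q] lessThan_atLeast0 o_def)
  qed
  have "(\<Sum>a\<in>P. real (snd a) * \<kappa>) \<le> (\<Sum>a\<in>P. \<Sum>t\<in>?I a. h ((shift ^^ t) ?y))"
  proof (rule sum_mono)
    fix a assume a: "a \<in> P"
    obtain q l where eq: "a = (q, l)" by fastforce
    show "real (snd a) * \<kappa> \<le> (\<Sum>t\<in>?I a. h ((shift ^^ t) ?y))"
      using blk[of "i + of_nat q" l] a unfolding eq by (simp add: P_def block_sum)
  qed
  also have "\<dots> = (\<Sum>t\<in>(\<Union>a\<in>P. ?I a). h ((shift ^^ t) ?y))"
    by (rule sum.UNION_disjoint[symmetric]) (use fin disj in auto)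
  also have "\<dots> \<le> (\<Sum>t<M. h ((shift ^^ t) ?y))"
    by (rule sum_mono2) (auto simp: P_def h)
  finally have covered: "(\<Sum>a\<in>P. real (snd a)) * \<kappa> \<le> orbit_sum h M ?y"
    by (simp add: orbit_sum_def sum_distrib_right)
  let ?T = "{..<M} \<inter> {t. i + of_nat t \<in> ?A}"
  \<comment> \<open>A coordinate at distance at least \<open>K\<close> from both ends can only lie
    in a bad block that fits into the window.\<close>
  have "?T \<subseteq> {..<K} \<union> {M - K..<M} \<union> (\<Union>a\<in>P. ?I a)"
  proof
    fix t assume t: "t \<in> ?T"
    show "t \<in> {..<K} \<union> {M - K..<M} \<union> (\<Union>a\<in>P. ?I a)"
    proof (cases "K \<le> t \<and> t < M - K")
      case True
      from t obtain p l where pl: "(p, l) \<in> bad" "i + of_nat t \<in> {p..<p + of_nat l}" by auto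
      from pl(2) obtain u where u: "u < l" "i + of_nat t = p + of_nat u" unfolding interval_eq by auto
      have lK: "l \<le> K" using K pl(1) by blast
      have "i + of_nat t = (i + of_nat (t - u)) + of_nat u"
        using u(1) lK True by (simp add: of_nat_add[symmetric] add.assoc del: of_nat_add)
      then have "p = i + of_nat (t - u)" using u(2) by simp
      then have "(t - u, l) \<in> P" unfolding P_def using pl(1) lK True by auto
      moreover have "t \<in> ?I (t - u, l)" using u(1) lK True by auto
      ultimately show ?thesis by blast
    qed (use t in auto)
  qed
  then have "card ?T \<le> card ({..<K} \<union> {M - K..<M} \<union> (\<Union>a\<in>P. ?I a))"
    by (rule card_mono[rotated]) (use fin in auto)
  also have "\<dots> \<le> card ({..<K} \<union> {M - K..<M}) + card (\<Union>a\<in>P. ?I a)" by (rule card_Un_le)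
  also have "\<dots> \<le> (card {..<K} + card {M - K..<M}) + (\<Sum>a\<in>P. card (?I a))"
    by (intro add_mono card_Un_le card_UN_le fin)
  also have "\<dots> \<le> 2 * K + (\<Sum>a\<in>P. snd a)" by (simp add: split_def)
  finally have "real (card ?T) \<le> real (2 * K + (\<Sum>a\<in>P. snd a))" by (rule of_nat_mono)
  then have "\<kappa> * real (card ?T) \<le> \<kappa> * (2 * real K + (\<Sum>a\<in>P. real (snd a)))"
    using \<kappa> by (intro mult_left_mono) auto
  also have "\<dots> \<le> \<kappa> * (2 * real K) + orbit_sum h M ?y"
    using covered by (simp add: algebra_simps)
  finally show ?thesis by (simp add: of_bool_def sum.If_cases)
qed

text \<open>The budget is half of \<open>\<epsilon>\<close>: a quarter for windows that are not
  erratic, an eighth for erratic ones, and an eighth for replacing the count over \<open>N\<close>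
  coordinates by an average over windows of length \<open>M\<close>.\<close>

theorem nonergodic_density_small:
  assumes cl: "closedin (weak_star X) (ergodic_measures X)"
    and op: "dstar_open X U" and sub: "Inr ` ergodic_measures X \<subseteq> U" and \<epsilon>: "\<epsilon> > 0"
  shows "\<exists>k0. \<forall>x\<in>X. \<forall>D. decomposition D \<and> (\<forall>(i, n)\<in>D. n \<ge> k0) \<and> (\<exists>K. \<forall>(i, n)\<in>D. n \<le> K) \<longrightarrow>
    upper_banach_density (nonergodic_coords U x D) < \<epsilon>"
proof -
  obtain L \<eta> where \<eta>: "\<eta> > 0" and near: "\<forall>B\<in>blocks X. \<forall>\<nu>\<in>ergodic_measures X.
      (\<forall>C. 1 \<le> length C \<and> length C \<le> L \<longrightarrow> \<bar>Fr B C - measure \<nu> (word_cylinder C \<inter> X)\<bar> < \<eta>) \<longrightarrow> Inl B \<in> U"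
    using open_neighbourhood_blocks[OF cl op sub] by blast
  define W :: "('i \<Rightarrow> 'a) set set" where "W = word_cylinder ` {C :: 'a list. 1 \<le> length C \<and> length C \<le> L}"
  have "finite {C :: 'a list. 1 \<le> length C \<and> length C \<le> L}"
    by (rule finite_subset[OF _ finite_lists_length_le[of "UNIV :: 'a set" L]]) auto
  then have W: "finite W" "\<And>B :: ('i \<Rightarrow> 'a) set. B \<in> W \<Longrightarrow> cylinder B"
    unfolding W_def using cylinder_word_cylinder by auto
  \<comment> \<open>The mean square deviation per coordinate that \<open>block_deviation\<close>
    guarantees in a long block outside \<open>U\<close>.\<close>
  define \<kappa> where "\<kappa> = (\<eta> / 2)\<^sup>2"
  have \<kappa>: "\<kappa> > 0" using \<eta> by (simp add: \<kappa>_def)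
  \<comment> \<open>A window with mean deviation below \<open>\<delta>\<close> has at most the
    fraction \<open>\<delta> / \<kappa> = \<epsilon> / 16\<close> of its coordinates in bad blocks
    contained in it.\<close>
  define \<delta> where "\<delta> = \<kappa> * \<epsilon> / 16"
  have \<delta>: "\<delta> > 0" using \<kappa> \<epsilon> by (simp add: \<delta>_def)
  have "\<epsilon> / 8 > 0" using \<epsilon> by simp
  from erratic_rare[OF cl W \<delta> this] obtain n where n: "n > 0" and rare: "\<forall>M>0. \<exists>N0. \<forall>N\<ge>N0. \<forall>y\<in>X.
      orbit_sum (visit (erratic W n M \<delta>)) N y \<le> \<epsilon> / 8 * real N" by blast
  define h where "h \<nu> z = (\<Sum>B\<in>W. deviation B n \<nu> z)" for \<nu> z
  have h0: "0 \<le> h \<nu> z" for \<nu> z unfolding h_def deviation_def by (intro sum_nonneg) simp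
  obtain k1 :: nat where k1: "(real L + real n) / (\<eta> / 2) \<le> real k1" using real_arch_simple by blast
  \<comment> \<open>Blocks of this length are nonempty, contain all words up to length
    \<open>L\<close>, and absorb the edge errors \<open>L\<close> and \<open>n\<close>.\<close>
  define k0 where "k0 = Suc (L + k1)"
  show ?thesis
  proof (intro exI[of _ k0] ballI allI impI, elim conjE exE)
    fix x and D :: "('i \<times> nat) set" and K :: nat
    assume x: "x \<in> X" and D: "decomposition D" and Dk0: "\<forall>(i, n)\<in>D. k0 \<le> n" and DK: "\<forall>(i, n)\<in>D. n \<le> K"
    define bad where "bad = {(i, n) \<in> D. Inl (subblock x i n) \<notin> U}"
    define A where "A = (\<Union>(p, l)\<in>bad. {p..<p + of_nat l})"
    have A_eq: "nonergodic_coords U x D = A" by (simp add: nonergodic_coords_def A_def bad_def)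
    have bad_sub: "bad \<subseteq> D" by (auto simp: bad_def)
    have blk: "real l * \<kappa> \<le> orbit_sum (h \<nu>) l (\<lambda>j. x (j + p))"
      if pl: "(p, l) \<in> bad" and \<nu>: "\<nu> \<in> ergodic_measures X" for p l \<nu>
    proof -
      have lk0: "k0 \<le> l" using pl Dk0 bad_sub by blast
      then have "1 \<le> l" "L \<le> l" "k1 \<le> l" by (simp_all add: k0_def)
      then have "(real L + real n) / (\<eta> / 2) \<le> real l" using k1 by linarith
      then have small: "real L + real n \<le> \<eta> / 2 * real l" using \<eta> by (simp add: field_simps)
      have "subblock x p l \<in> blocks X" using x \<open>1 \<le> l\<close> by (auto simp: blocks_def)
      moreover have "Inl (subblock x p l) \<notin> U" using pl by (simp add: bad_def)
      ultimately obtain C where C: "1 \<le> length C" "length C \<le> L"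
        "\<eta> \<le> \<bar>Fr (subblock x p l) C - measure \<nu> (word_cylinder C \<inter> X)\<bar>"
        using near \<nu> by (meson not_less)
      have "word_cylinder C \<in> W" unfolding W_def using C by blast
      then have le: "deviation (word_cylinder C) n \<nu> z \<le> h \<nu> z" for z
        unfolding h_def by (rule member_le_sum) (use W in \<open>auto simp: deviation_def\<close>)
      have "real l * \<kappa> \<le> orbit_sum (deviation (word_cylinder C) n \<nu>) l (\<lambda>j. x (j + p))"
        using block_deviation[OF C(1,2) \<open>L \<le> l\<close> small n C(3) \<eta>] unfolding \<kappa>_def deviation_def .
      also have "\<dots> \<le> orbit_sum (h \<nu>) l (\<lambda>j. x (j + p))"
        unfolding orbit_sum_def by (rule sum_mono) (rule le)
      finally show ?thesis .
    qed
    \<comment> \<open>Only now is \<open>K\<close> known: \<open>M\<close> makes the boundary loss 2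
      K at most an eighth of \<open>\<epsilon>\<close> times \<open>M\<close>.\<close>
    obtain M' :: nat where M': "16 * real K / \<epsilon> \<le> real M'" using real_arch_simple by blast
    define M where "M = Suc M'"
    have M: "M > 0" "16 * real K \<le> \<epsilon> * real M"
    proof -
      have "16 * real K \<le> \<epsilon> * real M'" using M' \<epsilon> by (simp add: field_simps)
      also have "\<dots> \<le> \<epsilon> * real M" using \<epsilon> by (simp add: M_def)
      finally show "16 * real K \<le> \<epsilon> * real M" .
    qed (simp add: M_def)
    obtain N0 where N0: "\<forall>N\<ge>N0. \<forall>y\<in>X. orbit_sum (visit (erratic W n M \<delta>)) N y \<le> \<epsilon> / 8 * real N"
      using rare M(1) by blast
    obtain N1 :: nat where N1: "8 * real M / \<epsilon> \<le> real N1" using real_arch_simple by blast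
    define N where "N = Suc (N0 + N1)"
    have "real N1 \<le> real N" by (simp add: N_def)
    then have "8 * real M / \<epsilon> \<le> real N" using N1 by linarith
    then have N: "N \<ge> 1" "N \<ge> N0" "8 * real M \<le> \<epsilon> * real N"
      using \<epsilon> by (simp_all add: N_def field_simps)
    have "real (card (A \<inter> {i..<i + of_nat N})) \<le> \<epsilon> / 2 * real N" for i
    proof -
      define a where "a t = (of_bool (i + of_nat t \<in> A) :: real)" for t
      define y where "y = (\<lambda>j. x (j + i))"
      have y: "y \<in> X" unfolding y_def by (rule translate[OF x])
      \<comment> \<open>An erratic window is charged in full. Otherwise a single \<nu> serves for
        all bad blocks in it, and the two losses \<open>\<epsilon> / 8\<close> and
        \<open>\<epsilon> / 16\<close> stay below \<open>\<epsilon> / 4\<close>.\<close>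
      have window: "(\<Sum>s<M. a (j + s)) / real M \<le> \<epsilon> / 4 + visit (erratic W n M \<delta>) ((shift ^^ j) y)" for j
      proof (cases "(shift ^^ j) y \<in> erratic W n M \<delta>")
        case True
        have "(\<Sum>s<M. a (j + s)) \<le> (\<Sum>s<M. 1)" unfolding a_def by (rule sum_mono) simp
        then have "(\<Sum>s<M. a (j + s)) / real M \<le> 1" using M(1) by (simp add: divide_le_eq)
        then show ?thesis using True \<epsilon> by simp
      next
        case False
        then obtain \<nu> where \<nu>: "\<nu> \<in> ergodic_measures X" "orbit_sum (h \<nu>) M ((shift ^^ j) y) < \<delta> * real M"
          unfolding erratic_def h_def by (auto simp: not_le)
        have y_eq: "(shift ^^ j) y = (\<lambda>k. x (k + (i + of_nat j)))"
          by (rule ext) (simp add: y_def shift_funpow_apply add_ac)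
        have K: "l \<le> K" if "(p, l) \<in> bad" for p l using that DK bad_sub by blast
        have "\<kappa> * (\<Sum>t<M. of_bool ((i + of_nat j) + of_nat t \<in> A)) \<le>
            \<kappa> * (2 * real K) + orbit_sum (h \<nu>) M (\<lambda>k. x (k + (i + of_nat j)))"
          unfolding A_def
          by (rule window_count[OF D bad_sub K h0 less_imp_le[OF \<kappa>] blk[OF _ \<nu>(1)]])
        also have "(\<Sum>t<M. of_bool ((i + of_nat j) + of_nat t \<in> A)) = (\<Sum>s<M. a (j + s))"
          by (simp only: a_def of_nat_add add.assoc)
        finally have "\<kappa> * (\<Sum>s<M. a (j + s)) \<le> \<kappa> * (2 * real K) + \<delta> * real M"
          using \<nu>(2) unfolding y_eq by linarith
        also have "\<dots> = \<kappa> * (2 * real K + \<epsilon> / 16 * real M)" by (simp add: \<delta>_def algebra_simps)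
        finally have "(\<Sum>s<M. a (j + s)) \<le> 2 * real K + \<epsilon> / 16 * real M" using \<kappa> by simp
        also have "\<dots> \<le> \<epsilon> / 4 * real M" using M(2) by (simp add: field_simps)
        finally have "(\<Sum>s<M. a (j + s)) / real M \<le> \<epsilon> / 4" using M(1) by (simp add: divide_le_eq)
        then show ?thesis using False by simp
      qed
      have "(\<Sum>j<N. a j) \<le> (\<Sum>j<N. (\<Sum>s<M. a (j + s)) / real M) + real M"
        using sliding_average_error[of a M N] M(1) by (simp add: a_def abs_le_iff)
      also have "(\<Sum>j<N. (\<Sum>s<M. a (j + s)) / real M) \<le>
          (\<Sum>j<N. \<epsilon> / 4 + visit (erratic W n M \<delta>) ((shift ^^ j) y))"
        by (rule sum_mono) (rule window)
      also have "\<dots> = real N * (\<epsilon> / 4) + orbit_sum (visit (erratic W n M \<delta>)) N y"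
        by (simp only: sum.distrib sum_constant card_lessThan orbit_sum_def)
      also have "orbit_sum (visit (erratic W n M \<delta>)) N y \<le> \<epsilon> / 8 * real N"
        using N0 N(2) y by blast
      finally have "(\<Sum>j<N. a j) \<le> \<epsilon> / 2 * real N" using N(3) by (simp add: field_simps)
      then show ?thesis unfolding card_Int_interval a_def .
    qed
    from upper_banach_density_le[OF N(1) this] show "upper_banach_density (nonergodic_coords U x D) < \<epsilon>"
      unfolding A_eq using \<epsilon> by linarith
  qed
qed

end

section \<open>The two-sided and the one-sided case\<close>

lemma subshift_two_sided:
  assumes "two_sided_subshift X"
  shows "subshift X"
proof
  have X: "closed X" "shift ` X = X" using assms by (auto simp: two_sided_subshift_def)
  show "closed X" "shift ` X \<subseteq> X" using X by auto
  have fwd: "(\<lambda>j. x (j + 1)) \<in> X" if "x \<in> X" for x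
    using X(2) that by (auto simp: shift_def)
  \<comment> \<open>On sequences over \<open>int\<close> the shift is injective, so the preimage in
    \<open>X\<close> provided by surjectivity is the backward translate.\<close>
  have bwd: "(\<lambda>j. x (j - 1)) \<in> X" if "x \<in> X" for x
  proof -
    have "x \<in> shift ` X" unfolding X(2) by (rule that)
    then obtain y where y: "x = shift y" "y \<in> X" by (rule imageE)
    have "(\<lambda>j. x (j - 1)) = y" by (rule ext) (simp add: y(1) shift_def)
    then show ?thesis using y by simp
  qed
  show "(\<lambda>j. x (j + i)) \<in> X" if "x \<in> X" for x i
  proof (induction i rule: int_induct[of _ 0])
    case base
    then show ?case using that by simp
  next
    case (step1 i)
    then show ?case using fwd[of "\<lambda>j. x (j + i)"] by (simp add: add_ac)
  next
    case (step2 i)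
    then show ?case using bwd[of "\<lambda>j. x (j + i)"] by (simp add: algebra_simps)
  qed
  show "{i..<i + of_nat n} = (\<lambda>j. i + of_nat j) ` {..<n}" for i :: int and n
  proof
    show "{i..<i + of_nat n} \<subseteq> (\<lambda>j. i + of_nat j) ` {..<n}"
    proof
      fix t assume "t \<in> {i..<i + of_nat n}"
      then show "t \<in> (\<lambda>j. i + of_nat j) ` {..<n}"
        by (intro image_eqI[of _ _ "nat (t - i)"]) auto
    qed
  qed auto
qed

lemma subshift_one_sided:
  assumes "one_sided_subshift X"
  shows "subshift X"
proof -
  interpret shift_space X
    by unfold_locales (use assms in \<open>auto simp: one_sided_subshift_def\<close>)
  show ?thesis
  proof
    show "(\<lambda>j. x (j + i)) \<in> X" if "x \<in> X" for x i
    proof -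
      have "(\<lambda>j. x (j + i)) = (shift ^^ i) x" by (rule ext) (simp add: shift_funpow_apply)
      then show ?thesis using shift_funpow_in[OF that] by simp
    qed
    show "{i..<i + of_nat n} = (\<lambda>j. i + of_nat j) ` {..<n}" for i n :: nat
    proof
      show "{i..<i + of_nat n} \<subseteq> (\<lambda>j. i + of_nat j) ` {..<n}"
      proof
        fix t assume "t \<in> {i..<i + of_nat n}"
        then show "t \<in> (\<lambda>j. i + of_nat j) ` {..<n}"
          by (intro image_eqI[of _ _ "t - i"]) auto
      qed
    qed auto
  qed
qed

theorem theorem2p10:
  "(\<forall>(X :: (int \<Rightarrow> 'a::{finite,discrete_topology}) set) U.
      two_sided_subshift X \<and> closedin (weak_star X) (ergodic_measures X) \<and>
      dstar_open X U \<and> Inr ` ergodic_measures X \<subseteq> U \<longrightarrow>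
      (\<forall>\<epsilon>>0. \<exists>k\<^sub>0. \<forall>x\<in>X. \<forall>D.
         decomposition D \<and> (\<forall>(i, n)\<in>D. n \<ge> k\<^sub>0) \<and> (\<exists>K. \<forall>(i, n)\<in>D. n \<le> K) \<longrightarrow>
         upper_banach_density (nonergodic_coords U x D) < \<epsilon>))
   \<and>
   (\<forall>(X :: (nat \<Rightarrow> 'a::{finite,discrete_topology}) set) U.
      one_sided_subshift X \<and> closedin (weak_star X) (ergodic_measures X) \<and>
      dstar_open X U \<and> Inr ` ergodic_measures X \<subseteq> U \<longrightarrow>
      (\<forall>\<epsilon>>0. \<exists>k\<^sub>0. \<forall>x\<in>X. \<forall>D.
         decomposition D \<and> (\<forall>(i, n)\<in>D. n \<ge> k\<^sub>0) \<and> (\<exists>K. \<forall>(i, n)\<in>D. n \<le> K) \<longrightarrow>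
         upper_banach_density (nonergodic_coords U x D) < \<epsilon>))"
  by (intro conjI allI impI; elim conjE)
     (rule subshift.nonergodic_density_small[OF subshift_two_sided]
        subshift.nonergodic_density_small[OF subshift_one_sided]; assumption)+

end
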